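(* Let $E$ be a nonautonomous attractor in $\mathbb{R}^d$ generated by $\{\Xi_k\}_{k\ge1}$, $\Xi_k=\{S_{k,1},\dots,S_{k,n_k}\}$. Let $\mu$ be a positive finite Borel measure on $\Sigma^\infty$, and let $\mu^\omega$ be its image measure under the projection $\Pi^\omega$. Assume that for each integer $k>0$ and all $i=1,2,\dots,n_k$, $$|S_{k,i}(x)-S_{k,i}(y)|\le c_{k,i}|x-y|\qquad\text{for } x,y\in J,$$ where $c_{k,i}<1$, and that $c_*=\inf_{k,i}c_{k,i}>0$ and $c^*=\sup_{k,i}c_{k,i}<1$. Then for all $q>0$, $$\underline{D}_q(\mu^\omega)\le\min\{d_q^-,d\}\quad\text{and}\quad \overline{D}_q(\mu^\omega)\le\min\{d_q^+,d\},$$ where $d_q^-$ and $d_q^+$ are the critical values defined (see context) with respect to the ratios $(c_{k,1},\dots,c_{k,n_k})_{k\ge1}$.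
   Context: **Words.** Let $\{n_k\}_{k\ge1}$ be integers $\ge2$; $\Sigma^k=\{u_1\cdots u_k:1\le u_j\le n_j\}$, $\Sigma^0=\{\emptyset\}$, $\Sigma^*=\bigcup_{k\ge0}\Sigma^k$, $\Sigma^\infty=\{u_1u_2\cdots:1\le u_k\le n_k\}$. For $\mathbf u=u_1\cdots u_k$ write $|\mathbf u|=k$ and $\mathbf u^-=u_1\cdots u_{k-1}$. $\mathcal C_{\mathbf u}\subset\Sigma^\infty$ is the cylinder of infinite words with prefix $\mathbf u$. **Nonautonomous attractor.** Let $J\subset\mathbb R^d$ be compact with non-empty interior and let $\Xi_k=\{S_{k,1},\dots,S_{k,n_k}\}$ be collections of contractive mappings. A collection $\{J_{\mathbf u}:\mathbf u\in\Sigma^*\}$ of closed subsets of $J$ fulfils the nonautonomous structure if: (1) $J_\emptyset=J$ and $J_{\mathbf u1},\dots,J_{\mathbf un_k}\subset J_{\mathbf u}$ for all $\mathbf u\in\Sigma^{k-1}$; (2) for each $\mathbf u=u_1\cdots u_k$, $J_{\mathbf u}=\Psi_{\mathbf u}(J)=\Psi_{u_1}\circ\cdots\circ\Psi_{u_k}(J)$, where $\Psi_{u_j}(x)=S_{j,u_j}x+\omega_{u_1\cdots u_j}$ for some $\omega_{u_1\cdots u_j}\in\mathbb R^d$; (3) $\lim_{k\to\infty}\max_{\mathbf u\in\Sigma^k}|J_{\mathbf u}|=0$, where $|\cdot|$ is diameter. The nonautonomous attractor is $E=\bigcap_{k\ge1}\bigcup_{\mathbf u\in\Sigma^k}J_{\mathbf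 u}$. The projection $\Pi^\omega:\Sigma^\infty\to E$ sends $\mathbf u=u_1u_2\cdots$ to the unique point of $\bigcap_{k}J_{u_1\cdots u_k}$, and $\mu^\omega(A)=\mu\{\mathbf u:\Pi^\omega(\mathbf u)\in A\}$. **Generalized $q$-dimensions.** Let $\mathcal M_r$ be the family of $r$-mesh cubes $[j_1r,(j_1+1)r)\times\cdots\times[j_dr,(j_d+1)r)$, $j_i\in\mathbb Z$. For a finite Borel measure $\nu$ on $\mathbb R^d$ and $q\ne1$, $\underline D_q(\nu)$ and $\overline D_q(\nu)$ are the $\liminf$ and $\limsup$ as $r\to0$ of $\frac{\log\sum_{Q\in\mathcal M_r}\nu(Q)^q}{(q-1)\log r}$; $\underline D_1(\nu)$ and $\overline D_1(\nu)$ are the $\liminf$ and $\limsup$ as $r\to0$ of $\frac{\sum_{Q\in\mathcal M_r}\nu(Q)\log\nu(Q)}{\log r}$. **Critical values.** Put $c_{\mathbf u}=c_{1,u_1}\cdots c_{k,u_k}$ ($c_\emptyset=1$), and for $s>0$, $0<r<1$, $\Sigma^*(s,r)=\{\mathbf u\in\Sigma^*:c_{\mathbf u}\le r<c_{\mathbf u^-}\}$. Let $F_q(s,r)=\sum_{\mathbf u\in\Sigma^*(s,r)}c_{\mathbf u}^{s(1-q)}\mu(\mathcal C_{\mathbf u})^q$ for $q\ne1$ and $F_1(s,r)=\sum_{\mathbf u\in\Sigma^*(s,r)}\mu(\mathcal C_{\mathbf u})\log\big(c_{\mathbf u}^{-s}\mu(\mathcal C_{\mathbf u})\big)$. Then -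 for $q\ge1$: $d_q^-=\sup\{s:\limsup_{r\to0}F_q(s,r)<\infty\}$, $d_q^+=\sup\{s:\liminf_{r\to0}F_q(s,r)<\infty\}$; - for $0<q<1$: $d_q^-=\inf\{s:\liminf_{r\to0}F_q(s,r)<\infty\}$, $d_q^+=\inf\{s:\limsup_{r\to0}F_q(s,r)<\infty\}$. Here $s$ ranges over $s>0$, with $\sup\emptyset=0$, $\inf\emptyset=+\infty$, $0\log0=0$.
   Formalization: For q=1 the total mass of μ is assumed to be at most 1 (the claim fails for twice Lebesgue measure on [0,1]); the translated maps Ψ are assumed to send J into J, so that their compositions on J are defined. *)

theory Defs
  imports "HOL-Analysis.Analysis"
begin

section \<open>Words\<close>

text \<open>
  Levels are numbered from 1: the alphabet at level \<open>k \<ge> 1\<close> is \<open>{1..n k}\<close> and \<open>n 0\<close> is never used.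
  A finite word is a list, so its \<open>k\<close>-th letter is \<open>u ! (k - 1)\<close>. An infinite word is a
  function on the levels \<open>{1..}\<close>, undefined at 0.
\<close>

definition words :: "(nat \<Rightarrow> nat) \<Rightarrow> nat \<Rightarrow> nat list set" where
  "words n k = {u. length u = k \<and> (\<forall>j<k. u ! j \<in> {1..n (Suc j)})}"

definition finite_words :: "(nat \<Rightarrow> nat) \<Rightarrow> nat list set" where
  "finite_words n = (\<Union>k. words n k)"

definition infinite_words :: "(nat \<Rightarrow> nat) \<Rightarrow> (nat \<Rightarrow> nat) set" where
  "infinite_words n = (\<Pi>\<^sub>E k\<in>{1..}. {1..n k})"

definition prefix_word :: "nat \<Rightarrow> (nat \<Rightarrow> nat) \<Rightarrow> nat list" where
  "prefix_word k w = map w [1..<Suc k]"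

definition cylinder :: "(nat \<Rightarrow> nat) \<Rightarrow> nat list \<Rightarrow> (nat \<Rightarrow> nat) set" where
  "cylinder n u = {w \<in> infinite_words n. prefix_word (length u) w = u}"

definition word_topology :: "(nat \<Rightarrow> nat) \<Rightarrow> (nat \<Rightarrow> nat) topology" where
  "word_topology n = product_topology (\<lambda>k. discrete_topology {1..n k}) {1..}"

definition borel_words :: "(nat \<Rightarrow> nat) \<Rightarrow> (nat \<Rightarrow> nat) measure" where
  "borel_words n = sigma (infinite_words n) {U. openin (word_topology n) U}"


section \<open>Nonautonomous attractors\<close>

text \<open>
  \<open>S k i\<close> is the \<open>i\<close>-th map of the \<open>k\<close>-th collection. The maps live on \<open>J\<close>; their values outside
  \<open>J\<close> are irrelevant. The translation in the last factor of the composition for \<open>u\<close> depends on the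
  whole word \<open>u\<close>, so that factor is indexed by \<open>u\<close> rather than by its last letter.
\<close>

definition factor_map ::
  "(nat \<Rightarrow> nat \<Rightarrow> 'a \<Rightarrow> 'a) \<Rightarrow> (nat list \<Rightarrow> 'a) \<Rightarrow> nat list \<Rightarrow> 'a \<Rightarrow> 'a::euclidean_space" where
  "factor_map S \<omega> u x = S (length u) (last u) x + \<omega> u"

definition word_map ::
  "(nat \<Rightarrow> nat \<Rightarrow> 'a \<Rightarrow> 'a) \<Rightarrow> (nat list \<Rightarrow> 'a) \<Rightarrow> nat list \<Rightarrow> 'a \<Rightarrow> 'a::euclidean_space" where
  "word_map S \<omega> u = foldr (\<circ>) (map (\<lambda>j. factor_map S \<omega> (take j u)) [1..<Suc (length u)]) id"

definition contractive_on :: "'a::euclidean_space set \<Rightarrow> ('a \<Rightarrow> 'a) \<Rightarrow> bool" where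
  "contractive_on J f \<longleftrightarrow>
     (\<exists>\<rho>. 0 \<le> \<rho> \<and> \<rho> < 1 \<and> (\<forall>x\<in>J. \<forall>y\<in>J. norm (f x - f y) \<le> \<rho> * norm (x - y)))"

text \<open>
  The condition \<open>factor_map S \<omega> u ` J \<subseteq> J\<close> says that the composition \<open>word_map S \<omega> u\<close> of maps with
  domain \<open>J\<close> is defined. It does not follow from the nesting of the sets \<open>JJ u\<close>, since the maps
  need not be injective.
\<close>

definition nonautonomous_structure ::
  "(nat \<Rightarrow> nat) \<Rightarrow> 'a::euclidean_space set \<Rightarrow> (nat \<Rightarrow> nat \<Rightarrow> 'a \<Rightarrow> 'a) \<Rightarrow> (nat list \<Rightarrow> 'a)
     \<Rightarrow> (nat list \<Rightarrow> 'a set) \<Rightarrow> bool" where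
  "nonautonomous_structure n J S \<omega> JJ \<longleftrightarrow>
     (\<forall>k\<ge>1. n k \<ge> 2) \<and>
     compact J \<and> interior J \<noteq> {} \<and>
     (\<forall>k\<ge>1. \<forall>i\<in>{1..n k}. contractive_on J (S k i)) \<and>
     (\<forall>u\<in>finite_words n. closed (JJ u) \<and> JJ u \<subseteq> J) \<and>
     JJ [] = J \<and>
     (\<forall>k\<ge>1. \<forall>u\<in>words n (k - 1). \<forall>i\<in>{1..n k}. JJ (u @ [i]) \<subseteq> JJ u) \<and>
     (\<forall>u\<in>finite_words n. u \<noteq> [] \<longrightarrow> factor_map S \<omega> u ` J \<subseteq> J) \<and>
     (\<forall>u\<in>finite_words n. JJ u = word_map S \<omega> u ` J) \<and>
     (\<lambda>k. MAX u\<in>words n k. diameter (JJ u)) \<longlonglongrightarrow> 0"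

definition nonautonomous_attractor ::
  "(nat \<Rightarrow> nat) \<Rightarrow> 'a::euclidean_space set \<Rightarrow> (nat \<Rightarrow> nat \<Rightarrow> 'a \<Rightarrow> 'a) \<Rightarrow> (nat list \<Rightarrow> 'a)
     \<Rightarrow> (nat list \<Rightarrow> 'a set) \<Rightarrow> 'a set \<Rightarrow> bool" where
  "nonautonomous_attractor n J S \<omega> JJ E \<longleftrightarrow>
     nonautonomous_structure n J S \<omega> JJ \<and> E = (\<Inter>k\<in>{1..}. \<Union>u\<in>words n k. JJ u)"

definition projection :: "(nat list \<Rightarrow> 'a set) \<Rightarrow> (nat \<Rightarrow> nat) \<Rightarrow> 'a" where
  "projection JJ w = (THE x. x \<in> (\<Inter>k\<in>{1..}. JJ (prefix_word k w)))"

definition image_measure ::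
  "(nat list \<Rightarrow> 'a::euclidean_space set) \<Rightarrow> (nat \<Rightarrow> nat) measure \<Rightarrow> 'a measure" where
  "image_measure JJ \<mu> = distr \<mu> borel (projection JJ)"


section \<open>Generalized dimensions\<close>

definition mesh :: "real \<Rightarrow> (real ^ 'd) set set" where
  "mesh r = range (\<lambda>j::'d \<Rightarrow> int.
     {x. \<forall>i. of_int (j i) * r \<le> x $ i \<and> x $ i < (of_int (j i) + 1) * r})"

definition ln_ereal :: "ereal \<Rightarrow> ereal" where
  "ln_ereal x = (if x \<le> 0 then -\<infinity> else if x = \<infinity> then \<infinity> else ereal (ln (real_of_ereal x)))"

text \<open>
  The sums are taken in \<^typ>\<open>ereal\<close>, where they always exist for a finite measure, as infinite
  values can occur for measures of unbounded support. The conventions \<open>0 powr q = 0\<close> and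
  \<open>0 * ln 0 = 0\<close> of the library are the intended ones.
\<close>

definition dim_quotient :: "(real ^ 'd) measure \<Rightarrow> real \<Rightarrow> real \<Rightarrow> ereal" where
  "dim_quotient \<nu> q r =
     (if q = 1
      then (\<Sum>\<^sub>\<infinity>Q\<in>mesh r. ereal (measure \<nu> Q * ln (measure \<nu> Q))) / ereal (ln r)
      else ln_ereal (\<Sum>\<^sub>\<infinity>Q\<in>mesh r. ereal (measure \<nu> Q powr q)) / ereal ((q - 1) * ln r))"

definition lower_dim :: "real \<Rightarrow> (real ^ 'd) measure \<Rightarrow> ereal" where
  "lower_dim q \<nu> = Liminf (at_right 0) (dim_quotient \<nu> q)"

definition upper_dim :: "real \<Rightarrow> (real ^ 'd) measure \<Rightarrow> ereal" where
  "upper_dim q \<nu> = Limsup (at_right 0) (dim_quotient \<nu> q)"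


section \<open>Critical values\<close>

definition word_ratio :: "(nat \<Rightarrow> nat \<Rightarrow> real) \<Rightarrow> nat list \<Rightarrow> real" where
  "word_ratio c u = (\<Prod>j<length u. c (Suc j) (u ! j))"

text \<open>
  The empty word has ratio 1 and never belongs to the cut set of any \<open>r < 1\<close>. The cut set is
  finite if the ratios are bounded away from 1.
\<close>

definition cut_set :: "(nat \<Rightarrow> nat) \<Rightarrow> (nat \<Rightarrow> nat \<Rightarrow> real) \<Rightarrow> real \<Rightarrow> nat list set" where
  "cut_set n c r =
     {u \<in> finite_words n. u \<noteq> [] \<and> word_ratio c u \<le> r \<and> r < word_ratio c (butlast u)}"

definition cut_sum ::
  "(nat \<Rightarrow> nat) \<Rightarrow> (nat \<Rightarrow> nat \<Rightarrow> real) \<Rightarrow> (nat \<Rightarrow> nat) measure \<Rightarrow> real \<Rightarrow> real \<Rightarrow> real \<Rightarrow> real" where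
  "cut_sum n c \<mu> q s r =
     (if q = 1
      then (\<Sum>u\<in>cut_set n c r.
              measure \<mu> (cylinder n u) * ln (word_ratio c u powr (- s) * measure \<mu> (cylinder n u)))
      else (\<Sum>u\<in>cut_set n c r.
              word_ratio c u powr (s * (1 - q)) * measure \<mu> (cylinder n u) powr q))"

text \<open>
  In \<^typ>\<open>ereal\<close> the supremum of the empty set is \<open>-\<infinity>\<close>; inserting 0 makes it 0 and changes no
  other supremum, as only \<open>s > 0\<close> are considered. The infimum of the empty set is \<open>\<infinity>\<close>.
\<close>

definition lower_critical ::
  "(nat \<Rightarrow> nat) \<Rightarrow> (nat \<Rightarrow> nat \<Rightarrow> real) \<Rightarrow> (nat \<Rightarrow> nat) measure \<Rightarrow> real \<Rightarrow> ereal" where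
  "lower_critical n c \<mu> q =
     (if q \<ge> 1
      then Sup (insert 0 {ereal s | s. s > 0 \<and>
              Limsup (at_right 0) (\<lambda>r. ereal (cut_sum n c \<mu> q s r)) < \<infinity>})
      else Inf {ereal s | s. s > 0 \<and>
              Liminf (at_right 0) (\<lambda>r. ereal (cut_sum n c \<mu> q s r)) < \<infinity>})"

definition upper_critical ::
  "(nat \<Rightarrow> nat) \<Rightarrow> (nat \<Rightarrow> nat \<Rightarrow> real) \<Rightarrow> (nat \<Rightarrow> nat) measure \<Rightarrow> real \<Rightarrow> ereal" where
  "upper_critical n c \<mu> q =
     (if q \<ge> 1
      then Sup (insert 0 {ereal s | s. s > 0 \<and>
              Liminf (at_right 0) (\<lambda>r. ereal (cut_sum n c \<mu> q s r)) < \<infinity>})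
      else Inf {ereal s | s. s > 0 \<and>
              Limsup (at_right 0) (\<lambda>r. ereal (cut_sum n c \<mu> q s r)) < \<infinity>})"

end

theory Submission
  imports Defs
begin

text \<open>
  Let \<open>u\<close> run over the cut set of \<open>r\<close>. Every \<open>J\<^sub>u\<close> has diameter at most \<open>r |J|\<close>, so it meets at most
  \<open>K\<close> mesh cubes of side \<open>r\<close>, with \<open>K\<close> independent of \<open>r\<close> and \<open>u\<close>. The cylinders of the cut set and
  the preimages of the mesh cubes are two partitions of the word space, and Jensen's inequality
  along each cylinder together with super- or subadditivity of \<open>x\<^sup>q\<close> (or \<open>x ln x\<close>) along each cube
  compares the sum over cylinders with the sum over cubes up to a power of \<open>K\<close>. As the ratio of
  \<open>u\<close> is comparable with \<open>r\<close>, the former sum is \<open>r\<^bsup>s(q-1)\<^esup> F\<^sub>q(s,r)\<close> up to constants, which gives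
  the bounds by the critical values. The bound by \<open>d\<close> is Jensen's inequality for the at most
  \<open>K r\<^bsup>-d\<^esup>\<close> cubes that meet \<open>J\<close>.
\<close>


section \<open>Inequalities for finite sums\<close>

text \<open>Bernoulli's inequality for real exponents, rescaled by \<open>t\<close>; it follows from
  the weighted AM-GM inequality. As any tangent point is allowed, Jensen will work with a mere bound
  on the number of terms.\<close>

lemma powr_ge_tangent:
  fixes q t x :: real
  assumes "q \<ge> 1" "t > 0" "x \<ge> 0"
  shows "x powr q \<ge> t powr q + q * t powr (q - 1) * (x - t)"
proof -
  \<comment> \<open>The tangent of \<open>y powr q\<close> at 1, evaluated at
    \<open>y = x / t\<close>. Where it is nonpositive the bound is trivial; elsewhere its
    \<open>q\<close>-th root is estimated.\<close>
  define z where "z = 1 + q * (x / t - 1)"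
  have "z \<le> (x / t) powr q"
  proof (cases "z > 0")
    case True
    have "z powr (1 / q) * 1 powr (1 - 1 / q) \<le> (1 / q) * z + (1 - 1 / q) * 1"
      using True assms by (intro Youngs_inequality_0) auto
    also have "\<dots> = x / t" using assms by (simp add: z_def field_simps)
    finally have "(z powr (1 / q)) powr q \<le> (x / t) powr q"
      using assms by (intro powr_mono2) auto
    then show ?thesis using True assms by (simp add: powr_powr)
  next
    case False
    then show ?thesis using powr_ge_zero[of "x / t" q] by linarith
  qed
  then have "t powr q * z \<le> t powr q * (x / t) powr q"
    by (intro mult_left_mono) auto
  also have "\<dots> = x powr q" using assms by (simp add: powr_divide)
  finally have "t powr q * z \<le> x powr q" .
  moreover have "t powr q = t * t powr (q - 1)" using assms by (simp add: powr_diff)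
  then have "t powr q * z = t powr q + q * t powr (q - 1) * (x - t)"
    using assms by (simp add: z_def field_simps)
  ultimately show ?thesis by simp
qed

text \<open>Weights \<open>q\<close> and \<open>1 - q\<close> in the weighted AM-GM inequality,
  applied to positive arguments. At \<open>x = 0\<close> the claim is
  \<open>(1 - q) * t powr q \<ge> 0\<close>.\<close>

lemma powr_le_tangent:
  fixes q t x :: real
  assumes "0 < q" "q < 1" "t > 0" "x \<ge> 0"
  shows "x powr q \<le> t powr q + q * t powr (q - 1) * (x - t)"
proof (cases "x = 0")
  case True
  have "q * t powr (q - 1) * t = q * t powr q" using assms by (simp add: powr_diff)
  also have "\<dots> \<le> t powr q" using assms by (simp add: mult_left_le_one_le)
  finally show ?thesis using True assms by simp
next
  case False
  have "(x / t) powr q * 1 powr (1 - q) \<le> q * (x / t) + (1 - q) * 1"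
    using False assms by (intro Youngs_inequality_0) auto
  then have "t powr q * (x / t) powr q \<le> t powr q * (q * (x / t) + (1 - q))"
    by (intro mult_left_mono) auto
  moreover have "t powr q * (x / t) powr q = x powr q" using assms by (simp add: powr_divide)
  moreover have "t powr q = t * t powr (q - 1)" using assms by (simp add: powr_diff)
  then have "t powr q * (q * (x / t) + (1 - q)) = t powr q + q * t powr (q - 1) * (x - t)"
    using assms by (simp add: field_simps)
  ultimately show ?thesis by simp
qed

text \<open>The right-hand side is the tangent at \<open>t\<close> of a convex function; the bound
  comes from \<open>ln y \<le> y - 1\<close> at \<open>y = t / x\<close>.\<close>

lemma mult_ln_ge_tangent:
  fixes t x :: real
  assumes "t > 0" "x \<ge> 0"
  shows "x * ln x \<ge> x * ln t + (x - t)"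
proof (cases "x = 0")
  case False
  then have "x > 0" using assms by simp
  have "ln (t / x) \<le> t / x - 1" using \<open>x > 0\<close> assms by (intro ln_le_minus_one) auto
  then have "x * ln (t / x) \<le> x * (t / x - 1)" using \<open>x > 0\<close> by (intro mult_left_mono) auto
  then show ?thesis using \<open>x > 0\<close> assms by (simp add: ln_div algebra_simps)
qed (use assms in auto)

section \<open>Jensen's inequality with a bound on the number of terms\<close>

text \<open>Summing the tangent bound at \<open>T / N\<close> gives Jensen's inequality. An upper
  bound \<open>N\<close> replaces the cardinality because the counts to come are estimates.\<close>

lemma sum_powr_ge:
  fixes f :: "'i \<Rightarrow> real"
  assumes "finite A" "\<And>i. i \<in> A \<Longrightarrow> f i \<ge> 0" "real (card A) \<le> N" "N > 0" "q \<ge> 1"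
  shows "(\<Sum>i\<in>A. f i) powr q \<le> N powr (q - 1) * (\<Sum>i\<in>A. f i powr q)"
proof (cases "(\<Sum>i\<in>A. f i) > 0")
  case True
  define T where "T = (\<Sum>i\<in>A. f i)"
  define t where "t = T / N"
  have "t > 0" using True assms by (simp add: t_def T_def)
  have tq: "t powr q = t * t powr (q - 1)" using \<open>t > 0\<close> by (simp add: powr_diff)
  have T: "T = N * t" using assms by (simp add: t_def)
  have "N * t powr q = q * t powr (q - 1) * T + N * t powr q * (1 - q)"
    unfolding tq T by (simp add: algebra_simps)
  \<comment> \<open>The factor \<open>1 - q\<close> is nonpositive, so passing from \<open>N\<close>
    to the smaller \<open>card A\<close> goes the right way.\<close>
  also have "\<dots> \<le> q * t powr (q - 1) * T + card A * t powr q * (1 - q)"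
    using assms by (intro add_left_mono mult_right_mono_neg mult_right_mono) auto
  also have "\<dots> = (\<Sum>i\<in>A. t powr q + q * t powr (q - 1) * (f i - t))"
    unfolding tq by (simp add: sum.distrib sum_distrib_left sum_distrib_right sum_subtractf T_def algebra_simps)
  also have "\<dots> \<le> (\<Sum>i\<in>A. f i powr q)"
    using assms \<open>t > 0\<close> by (intro sum_mono powr_ge_tangent) auto
  finally have "N powr (q - 1) * (N * t powr q) \<le> N powr (q - 1) * (\<Sum>i\<in>A. f i powr q)"
    by (intro mult_left_mono) auto
  moreover have "N powr (q - 1) * (N * t powr q) = T powr q"
    using True assms by (simp add: t_def T_def powr_divide powr_diff)
  ultimately show ?thesis by (simp add: T_def)
next
  case False
  then have "(\<Sum>i\<in>A. f i) = 0" using assms sum_nonneg[of A f] by force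
  then show ?thesis by (simp add: sum_nonneg)
qed

text \<open>The same argument for the concave power; \<open>1 - q\<close> is now positive, so the
  cardinality may be enlarged to \<open>N\<close>.\<close>

lemma sum_powr_le:
  fixes f :: "'i \<Rightarrow> real"
  assumes "finite A" "\<And>i. i \<in> A \<Longrightarrow> f i \<ge> 0" "real (card A) \<le> N" "N > 0" "0 < q" "q < 1"
  shows "(\<Sum>i\<in>A. f i powr q) \<le> N powr (1 - q) * (\<Sum>i\<in>A. f i) powr q"
proof (cases "(\<Sum>i\<in>A. f i) > 0")
  case True
  define T where "T = (\<Sum>i\<in>A. f i)"
  define t where "t = T / N"
  have "t > 0" using True assms by (simp add: t_def T_def)
  have tq: "t powr q = t * t powr (q - 1)" using \<open>t > 0\<close> by (simp add: powr_diff)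
  have T: "T = N * t" using assms by (simp add: t_def)
  have "(\<Sum>i\<in>A. f i powr q) \<le> (\<Sum>i\<in>A. t powr q + q * t powr (q - 1) * (f i - t))"
    using assms \<open>t > 0\<close> by (intro sum_mono powr_le_tangent) auto
  also have "\<dots> = q * t powr (q - 1) * T + card A * t powr q * (1 - q)"
    unfolding tq by (simp add: sum.distrib sum_distrib_left sum_distrib_right sum_subtractf T_def algebra_simps)
  also have "\<dots> \<le> q * t powr (q - 1) * T + N * t powr q * (1 - q)"
    using assms by (intro add_left_mono mult_right_mono) auto
  also have "\<dots> = N * t powr q"
    unfolding tq T by (simp add: algebra_simps)
  also have "\<dots> = N powr (1 - q) * T powr q"
    using True assms by (simp add: t_def T_def powr_divide powr_diff)
  finally show ?thesis by (simp add: T_def)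
next
  case False
  then have "(\<Sum>i\<in>A. f i) = 0" using assms sum_nonneg[of A f] by force
  then have "\<forall>i\<in>A. f i = 0" using assms by (simp add: sum_nonneg_eq_0_iff)
  then show ?thesis by simp
qed

text \<open>Jensen for \<open>x * ln x\<close>: spreading a mass over at most \<open>N\<close> terms
  costs at most \<open>ln N\<close> per unit of mass.\<close>

lemma sum_mult_ln_ge:
  fixes f :: "'i \<Rightarrow> real"
  assumes "finite A" "\<And>i. i \<in> A \<Longrightarrow> f i \<ge> 0" "real (card A) \<le> N" "N > 0"
  shows "(\<Sum>i\<in>A. f i) * ln (\<Sum>i\<in>A. f i) - (\<Sum>i\<in>A. f i) * ln N \<le> (\<Sum>i\<in>A. f i * ln (f i))"
proof (cases "(\<Sum>i\<in>A. f i) > 0")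
  case True
  define T where "T = (\<Sum>i\<in>A. f i)"
  define t where "t = T / N"
  have "t > 0" using True assms by (simp add: t_def T_def)
  have "card A * t \<le> N * t" using assms \<open>t > 0\<close> by (intro mult_right_mono) auto
  \<comment> \<open>Since \<open>T = N * t\<close>, the added term \<open>T - card A * t\<close> is
    nonnegative.\<close>
  then have "T * ln t \<le> T * ln t + (T - card A * t)" using assms by (simp add: t_def)
  also have "\<dots> = (\<Sum>i\<in>A. f i * ln t + (f i - t))"
    by (simp add: sum.distrib sum_distrib_right[symmetric] sum_subtractf T_def)
  also have "\<dots> \<le> (\<Sum>i\<in>A. f i * ln (f i))"
    using assms \<open>t > 0\<close> by (intro sum_mono mult_ln_ge_tangent) auto
  finally show ?thesis using True assms by (simp add: t_def T_def ln_div algebra_simps)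
next
  case False
  then have "(\<Sum>i\<in>A. f i) = 0" using assms sum_nonneg[of A f] by force
  then have "\<forall>i\<in>A. f i = 0" using assms by (simp add: sum_nonneg_eq_0_iff)
  then show ?thesis by simp
qed

section \<open>Superadditivity and subadditivity\<close>

text \<open>In \<open>x powr q = x * x powr (q - 1)\<close> the second factor of each term is at
  most that of the total, as \<open>q - 1 \<ge> 0\<close>.\<close>

lemma sum_powr_superadditive:
  fixes f :: "'i \<Rightarrow> real"
  assumes "finite A" "\<And>i. i \<in> A \<Longrightarrow> f i \<ge> 0" "q \<ge> 1"
  shows "(\<Sum>i\<in>A. f i powr q) \<le> (\<Sum>i\<in>A. f i) powr q"
proof -
  define T where "T = (\<Sum>i\<in>A. f i)"
  have split: "x powr q = x * x powr (q - 1)" if "x \<ge> 0" for x :: real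
    using that by (cases "x = 0") (auto simp: powr_diff)
  have "T \<ge> 0" using assms by (simp add: T_def sum_nonneg)
  have "(\<Sum>i\<in>A. f i powr q) = (\<Sum>i\<in>A. f i * f i powr (q - 1))"
    using assms by (intro sum.cong split) auto
  also have "\<dots> \<le> (\<Sum>i\<in>A. f i * T powr (q - 1))"
    unfolding T_def using assms by (intro sum_mono mult_left_mono powr_mono2 member_le_sum) auto
  also have "\<dots> = T powr q"
    using \<open>T \<ge> 0\<close> by (simp add: split sum_distrib_right[symmetric] T_def)
  finally show ?thesis by (simp add: T_def)
qed

text \<open>With \<open>q - 1 \<le> 0\<close> the second factor decreases on positive numbers, so
  zero terms are treated apart.\<close>

lemma sum_powr_subadditive:
  fixes f :: "'i \<Rightarrow> real"
  assumes "finite A" "\<And>i. i \<in> A \<Longrightarrow> f i \<ge> 0" "q \<le> 1"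
  shows "(\<Sum>i\<in>A. f i) powr q \<le> (\<Sum>i\<in>A. f i powr q)"
proof -
  define T where "T = (\<Sum>i\<in>A. f i)"
  have split: "x powr q = x * x powr (q - 1)" if "x \<ge> 0" for x :: real
    using that by (cases "x = 0") (auto simp: powr_diff)
  have "T \<ge> 0" using assms by (simp add: T_def sum_nonneg)
  then have "T powr q = (\<Sum>i\<in>A. f i * T powr (q - 1))"
    by (simp add: split sum_distrib_right[symmetric] T_def)
  also have "\<dots> \<le> (\<Sum>i\<in>A. f i * f i powr (q - 1))"
  proof (rule sum_mono)
    fix i assume i: "i \<in> A"
    show "f i * T powr (q - 1) \<le> f i * f i powr (q - 1)"
    proof (cases "f i = 0")
      case False
      then have "f i > 0" "f i \<le> T"
        unfolding T_def using assms i by (auto intro!: member_le_sum simp: less_le)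
      then show ?thesis using assms by (intro mult_left_mono powr_mono2') auto
    qed simp
  qed
  also have "\<dots> = (\<Sum>i\<in>A. f i powr q)"
    using assms by (intro sum.cong split[symmetric]) auto
  finally show ?thesis by (simp add: T_def)
qed

lemma sum_mult_ln_superadditive:
  fixes f :: "'i \<Rightarrow> real"
  assumes "finite A" "\<And>i. i \<in> A \<Longrightarrow> f i \<ge> 0"
  shows "(\<Sum>i\<in>A. f i * ln (f i)) \<le> (\<Sum>i\<in>A. f i) * ln (\<Sum>i\<in>A. f i)"
proof -
  have "(\<Sum>i\<in>A. f i * ln (f i)) \<le> (\<Sum>i\<in>A. f i * ln (\<Sum>i\<in>A. f i))"
  proof (rule sum_mono)
    fix i assume i: "i \<in> A"
    show "f i * ln (f i) \<le> f i * ln (\<Sum>i\<in>A. f i)"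
    proof (cases "f i = 0")
      case False
      then have "f i > 0" "f i \<le> (\<Sum>i\<in>A. f i)"
        using assms i by (auto intro!: member_le_sum simp: less_le)
      then show ?thesis by (intro mult_left_mono) auto
    qed simp
  qed
  then show ?thesis by (simp add: sum_distrib_right)
qed

text \<open>
  In the next three lemmas \<open>m u v\<close> is the mass that two partitions give to the common part of
  their pieces \<open>u\<close> and \<open>v\<close>, and each \<open>u\<close> meets at most \<open>N\<close> of the pieces \<open>v\<close>.
\<close>

lemma sum_marginal_powr_le:
  fixes m :: "'i \<Rightarrow> 'j \<Rightarrow> real"
  assumes "finite U" "finite V" "\<And>u v. m u v \<ge> 0" "N > 0" "q \<ge> 1"
    and N: "\<And>u. u \<in> U \<Longrightarrow> real (card {v\<in>V. m u v \<noteq> 0}) \<le> N"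
  shows "(\<Sum>u\<in>U. (\<Sum>v\<in>V. m u v) powr q) \<le> N powr (q - 1) * (\<Sum>v\<in>V. (\<Sum>u\<in>U. m u v) powr q)"
proof -
  have "(\<Sum>v\<in>V. m u v) powr q \<le> N powr (q - 1) * (\<Sum>v\<in>V. m u v powr q)" if "u \<in> U" for u
  proof -
    \<comment> \<open>Zero entries drop out on both sides (\<open>0 powr q = 0\<close>), so Jensen
      sees at most \<open>N\<close> terms however large \<open>V\<close> is.\<close>
    have "(\<Sum>v\<in>V. m u v) = (\<Sum>v\<in>{v\<in>V. m u v \<noteq> 0}. m u v)"
      using assms by (intro sum.mono_neutral_right) auto
    moreover have "(\<Sum>v\<in>V. m u v powr q) = (\<Sum>v\<in>{v\<in>V. m u v \<noteq> 0}. m u v powr q)"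
      using assms by (intro sum.mono_neutral_right) auto
    ultimately show ?thesis using sum_powr_ge[of "{v\<in>V. m u v \<noteq> 0}" "m u" N q] assms that by simp
  qed
  then have "(\<Sum>u\<in>U. (\<Sum>v\<in>V. m u v) powr q) \<le> (\<Sum>u\<in>U. N powr (q - 1) * (\<Sum>v\<in>V. m u v powr q))"
    by (rule sum_mono)
  also have "\<dots> = N powr (q - 1) * (\<Sum>v\<in>V. \<Sum>u\<in>U. m u v powr q)"
    by (simp add: sum_distrib_left[symmetric] sum.swap[of _ V U])
  also have "\<dots> \<le> N powr (q - 1) * (\<Sum>v\<in>V. (\<Sum>u\<in>U. m u v) powr q)"
    using assms by (intro mult_left_mono sum_mono sum_powr_superadditive) auto
  finally show ?thesis .
qed

lemma sum_marginal_powr_ge: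
  fixes m :: "'i \<Rightarrow> 'j \<Rightarrow> real"
  assumes "finite U" "finite V" "\<And>u v. m u v \<ge> 0" "N > 0" "0 < q" "q < 1"
    and N: "\<And>u. u \<in> U \<Longrightarrow> real (card {v\<in>V. m u v \<noteq> 0}) \<le> N"
  shows "(\<Sum>v\<in>V. (\<Sum>u\<in>U. m u v) powr q) \<le> N powr (1 - q) * (\<Sum>u\<in>U. (\<Sum>v\<in>V. m u v) powr q)"
proof -
  have row: "(\<Sum>v\<in>V. m u v powr q) \<le> N powr (1 - q) * (\<Sum>v\<in>V. m u v) powr q" if "u \<in> U" for u
  proof -
    have "(\<Sum>v\<in>V. m u v) = (\<Sum>v\<in>{v\<in>V. m u v \<noteq> 0}. m u v)"
      using assms by (intro sum.mono_neutral_right) auto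
    moreover have "(\<Sum>v\<in>V. m u v powr q) = (\<Sum>v\<in>{v\<in>V. m u v \<noteq> 0}. m u v powr q)"
      using assms by (intro sum.mono_neutral_right) auto
    ultimately show ?thesis using sum_powr_le[of "{v\<in>V. m u v \<noteq> 0}" "m u" N q] assms that by simp
  qed
  have "(\<Sum>v\<in>V. (\<Sum>u\<in>U. m u v) powr q) \<le> (\<Sum>v\<in>V. \<Sum>u\<in>U. m u v powr q)"
    using assms by (intro sum_mono sum_powr_subadditive) auto
  also have "\<dots> = (\<Sum>u\<in>U. \<Sum>v\<in>V. m u v powr q)" by (rule sum.swap)
  also have "\<dots> \<le> (\<Sum>u\<in>U. N powr (1 - q) * (\<Sum>v\<in>V. m u v) powr q)"
    by (intro sum_mono row)
  finally show ?thesis by (simp add: sum_distrib_left)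
qed

lemma sum_marginal_mult_ln_le:
  fixes m :: "'i \<Rightarrow> 'j \<Rightarrow> real"
  assumes "finite U" "finite V" "\<And>u v. m u v \<ge> 0" "N > 0"
    and N: "\<And>u. u \<in> U \<Longrightarrow> real (card {v\<in>V. m u v \<noteq> 0}) \<le> N"
  shows "(\<Sum>u\<in>U. (\<Sum>v\<in>V. m u v) * ln (\<Sum>v\<in>V. m u v)) - (\<Sum>u\<in>U. \<Sum>v\<in>V. m u v) * ln N
    \<le> (\<Sum>v\<in>V. (\<Sum>u\<in>U. m u v) * ln (\<Sum>u\<in>U. m u v))"
proof -
  have row: "(\<Sum>v\<in>V. m u v) * ln (\<Sum>v\<in>V. m u v) - (\<Sum>v\<in>V. m u v) * ln N
      \<le> (\<Sum>v\<in>V. m u v * ln (m u v))" if "u \<in> U" for u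
  proof -
    have "(\<Sum>v\<in>V. m u v) = (\<Sum>v\<in>{v\<in>V. m u v \<noteq> 0}. m u v)"
      using assms by (intro sum.mono_neutral_right) auto
    moreover have "(\<Sum>v\<in>V. m u v * ln (m u v)) = (\<Sum>v\<in>{v\<in>V. m u v \<noteq> 0}. m u v * ln (m u v))"
      using assms by (intro sum.mono_neutral_right) auto
    ultimately show ?thesis using sum_mult_ln_ge[of "{v\<in>V. m u v \<noteq> 0}" "m u" N] assms that by simp
  qed
  have "(\<Sum>u\<in>U. (\<Sum>v\<in>V. m u v) * ln (\<Sum>v\<in>V. m u v)) - (\<Sum>u\<in>U. \<Sum>v\<in>V. m u v) * ln N
      = (\<Sum>u\<in>U. (\<Sum>v\<in>V. m u v) * ln (\<Sum>v\<in>V. m u v) - (\<Sum>v\<in>V. m u v) * ln N)"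
    by (simp add: sum_subtractf sum_distrib_right)
  also have "\<dots> \<le> (\<Sum>u\<in>U. \<Sum>v\<in>V. m u v * ln (m u v))"
    by (intro sum_mono row)
  also have "\<dots> = (\<Sum>v\<in>V. \<Sum>u\<in>U. m u v * ln (m u v))" by (rule sum.swap)
  also have "\<dots> \<le> (\<Sum>v\<in>V. (\<Sum>u\<in>U. m u v) * ln (\<Sum>u\<in>U. m u v))"
    using assms by (intro sum_mono sum_mult_ln_superadditive) auto
  finally show ?thesis .
qed

section \<open>Error terms that vanish as \<open>r\<close> tends to 0\<close>

text \<open>A multiplicative constant in a sum turns into \<open>K / (- ln r)\<close> once
  logarithms are divided by \<open>ln r\<close>.\<close>

lemma tendsto_add_divide_minus_ln:
  fixes s K :: real
  shows "((\<lambda>r. s + K / (- ln r)) \<longlongrightarrow> s) (at_right 0)"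
proof -
  have "LIM r at_right (0::real). - ln r :> at_top"
    using ln_at_0 by (simp add: filterlim_uminus_at_top)
  then have "((\<lambda>r. K / (- ln r)) \<longlongrightarrow> 0) (at_right 0)"
    by (intro tendsto_divide_0[OF tendsto_const] filterlim_at_top_imp_at_infinity)
  then have "((\<lambda>r. s + K / (- ln r)) \<longlongrightarrow> s + 0) (at_right 0)"
    by (intro tendsto_add tendsto_const)
  then show ?thesis by simp
qed

lemma Limsup_le_of_eventually_le_ln:
  fixes G :: "real \<Rightarrow> ereal"
  assumes "\<forall>\<^sub>F r in at_right 0. G r \<le> ereal (s + K / (- ln r))"
  shows "Limsup (at_right 0) G \<le> ereal s"
proof -
  have "Limsup (at_right 0) G \<le> Limsup (at_right 0) (\<lambda>r. ereal (s + K / (- ln r)))"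
    using assms by (rule Limsup_mono)
  also have "\<dots> = ereal s"
    by (intro lim_imp_Limsup tendsto_ereal tendsto_add_divide_minus_ln) simp
  finally show ?thesis .
qed

text \<open>Arbitrarily small \<open>r\<close> suffice for a lower limit: a number \<open>y\<close>
  strictly between \<open>s\<close> and the lower limit would eventually separate the bound from
  \<open>G r\<close>.\<close>

lemma Liminf_le_of_frequently_le_ln:
  fixes G :: "real \<Rightarrow> ereal"
  assumes "\<exists>\<^sub>F r in at_right 0. G r \<le> ereal (s + K / (- ln r))"
  shows "Liminf (at_right 0) G \<le> ereal s"
proof (rule ccontr)
  assume "\<not> ?thesis"
  then obtain y where y: "ereal s < y" "y < Liminf (at_right 0) G" 
    by (meson dense not_le)
  have "((\<lambda>r. ereal (s + K / (- ln r))) \<longlongrightarrow> ereal s) (at_right 0)"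
    by (intro tendsto_ereal tendsto_add_divide_minus_ln)
  then have "\<forall>\<^sub>F r in at_right 0. ereal (s + K / (- ln r)) < y"
    using y(1) by (rule order_tendstoD)
  moreover have "\<forall>\<^sub>F r in at_right 0. y < G r" using y(2) by (rule less_LiminfD)
  ultimately have "\<forall>\<^sub>F r in at_right 0. \<not> G r \<le> ereal (s + K / (- ln r))"
    by eventually_elim auto
  then show False using assms by (simp add: frequently_def)
qed


section \<open>Mesh cubes\<close>

text \<open>Gives the members of \<open>mesh r\<close> an integer index by which they can be told
  apart and counted.\<close>

definition mesh_cube :: "real \<Rightarrow> ('d \<Rightarrow> int) \<Rightarrow> (real ^ 'd) set" where
  "mesh_cube r j = {x. \<forall>i. of_int (j i) * r \<le> x $ i \<and> x $ i < (of_int (j i) + 1) * r}"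

lemma mesh_eq_range: "mesh r = range (mesh_cube r)"
  by (simp add: mesh_def mesh_cube_def[abs_def])

text \<open>Half-open intervals of length \<open>r\<close> are the fibres of the floor of
  \<open>x $ i / r\<close>; hence the cubes form a partition.\<close>

lemma in_mesh_cube_iff:
  assumes "r > 0"
  shows "x \<in> mesh_cube r j \<longleftrightarrow> j = (\<lambda>i. \<lfloor>x $ i / r\<rfloor>)"
proof -
  have "of_int (j i) * r \<le> x $ i \<and> x $ i < (of_int (j i) + 1) * r \<longleftrightarrow> j i = \<lfloor>x $ i / r\<rfloor>" for i
    using floor_eq_iff[of "x $ i / r" "j i"] assms by (auto simp: field_simps)
  then show ?thesis by (auto simp: mesh_cube_def)
qed

lemma mesh_disjoint:
  assumes "r > 0" "Q \<in> mesh r" "Q' \<in> mesh r" "Q \<noteq> Q'"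
  shows "Q \<inter> Q' = {}"
  using assms by (auto simp: mesh_eq_range in_mesh_cube_iff)

lemma mesh_covers:
  assumes "r > 0"
  shows "\<exists>Q\<in>mesh r. x \<in> Q"
  using assms by (auto simp: mesh_eq_range in_mesh_cube_iff)

lemma mesh_in_borel:
  fixes Q :: "(real ^ 'd) set"
  assumes "Q \<in> mesh r"
  shows "Q \<in> sets borel"
proof -
  obtain j where Q: "Q = mesh_cube r j" using assms by (auto simp: mesh_eq_range)
  have "Q = (\<Inter>i\<in>UNIV. {x \<in> space borel. of_int (j i) * r \<le> x $ i} \<inter>
      {x \<in> space borel. x $ i < (of_int (j i) + 1) * r})"
    unfolding Q mesh_cube_def by auto
  also have "\<dots> \<in> sets borel"
    by (intro sets.countable_INT'' sets.Int borel_measurable_le borel_measurable_less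
        borel_measurable_const borel_measurable_continuous_onI continuous_intros) auto
  finally show ?thesis .
qed

text \<open>Each coordinate index of a cube meeting \<open>A\<close> takes at most
  \<open>2 * \<lfloor>L / r\<rfloor> + 3\<close> values. The bound depends on \<open>L / r\<close>
  only, so it is uniform in \<open>r\<close> when \<open>L\<close> is proportional to
  \<open>r\<close>.\<close>

lemma card_mesh_meeting:
  fixes A :: "(real ^ 'd) set"
  assumes "r > 0" "L \<ge> 0" and diam: "\<And>x y. x \<in> A \<Longrightarrow> y \<in> A \<Longrightarrow> norm (x - y) \<le> L"
  shows "finite {Q \<in> mesh r. Q \<inter> A \<noteq> {}}"
    and "real (card {Q \<in> mesh r. Q \<inter> A \<noteq> {}}) \<le> (2 * L / r + 3) ^ CARD('d)"
proof -
  have "finite {Q \<in> mesh r. Q \<inter> A \<noteq> {}} \<and>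
    real (card {Q \<in> mesh r. Q \<inter> A \<noteq> {}}) \<le> (2 * L / r + 3) ^ CARD('d)"
  proof (cases "A = {}")
    case True
    then show ?thesis using assms by simp
  next
    case False
    then obtain p where p: "p \<in> A" by auto
    \<comment> \<open>Floors of two reals at distance at most \<open>L / r\<close> differ by at most
      this integer.\<close>
    define N where "N = \<lfloor>L / r\<rfloor> + 1"
    have "N \<ge> 0" using \<open>L \<ge> 0\<close> \<open>r > 0\<close> by (simp add: N_def add_nonneg_nonneg)
    define B where "B = (\<Pi>\<^sub>E i\<in>(UNIV :: 'd set). {\<lfloor>p $ i / r\<rfloor> - N..\<lfloor>p $ i / r\<rfloor> + N})"
    have fin: "finite B" unfolding B_def by (intro finite_PiE) auto
    have sub: "{Q \<in> mesh r. Q \<inter> A \<noteq> {}} \<subseteq> mesh_cube r ` B"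
    proof
      fix Q assume "Q \<in> {Q \<in> mesh r. Q \<inter> A \<noteq> {}}"
      then obtain j x where Q: "Q = mesh_cube r j" "x \<in> A" "x \<in> mesh_cube r j"
        by (auto simp: mesh_eq_range)
      then have j: "j = (\<lambda>i. \<lfloor>x $ i / r\<rfloor>)" using \<open>r > 0\<close> by (simp add: in_mesh_cube_iff)
      have "\<bar>j i - \<lfloor>p $ i / r\<rfloor>\<bar> \<le> N" for i
      proof -
        have "\<bar>x $ i - p $ i\<bar> \<le> L"
          using component_le_norm_cart[of "x - p" i] diam[OF Q(2) p] by simp
        then have "\<bar>x $ i / r - p $ i / r\<bar> \<le> L / r"
          using \<open>r > 0\<close> by (simp add: diff_divide_distrib[symmetric] divide_right_mono)
        then show ?thesis unfolding j N_def by linarith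
      qed
      then have "\<lfloor>p $ i / r\<rfloor> - N \<le> j i \<and> j i \<le> \<lfloor>p $ i / r\<rfloor> + N" for i
        by (simp add: abs_le_iff algebra_simps)
      then have "j \<in> B" by (simp add: B_def PiE_UNIV_domain)
      then show "Q \<in> mesh_cube r ` B" using Q by simp
    qed
    have "real (card {Q \<in> mesh r. Q \<inter> A \<noteq> {}}) \<le> real (card (mesh_cube r ` B))"
      using fin sub by (simp add: card_mono)
    also have "\<dots> \<le> real (card B)" using fin by (simp add: card_image_le)
    also have "\<dots> = (2 * real_of_int \<lfloor>L / r\<rfloor> + 3) ^ CARD('d)"
      using \<open>N \<ge> 0\<close> by (simp add: B_def card_PiE N_def add.commute)
    also have "\<dots> \<le> (2 * L / r + 3) ^ CARD('d)"
    proof (intro power_mono)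
      show "2 * real_of_int \<lfloor>L / r\<rfloor> + 3 \<le> 2 * L / r + 3"
        using of_int_floor_le[of "L / r"] by (simp add: times_divide_eq_right[symmetric] del: times_divide_eq_right)
    qed (use \<open>L \<ge> 0\<close> \<open>r > 0\<close> in auto)
    finally show ?thesis using finite_subset[OF sub] fin by blast
  qed
  then show "finite {Q \<in> mesh r. Q \<inter> A \<noteq> {}}"
    and "real (card {Q \<in> mesh r. Q \<inter> A \<noteq> {}}) \<le> (2 * L / r + 3) ^ CARD('d)" by auto
qed


section \<open>Words and cylinders\<close>

lemma length_prefix_word [simp]: "length (prefix_word k w) = k"
  by (simp add: prefix_word_def)

lemma prefix_word_0 [simp]: "prefix_word 0 w = []"
  by (simp add: prefix_word_def)

lemma prefix_word_Suc: "prefix_word (Suc k) w = prefix_word k w @ [w (Suc k)]"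
  by (simp add: prefix_word_def)

lemma prefix_word_in_words:
  assumes "w \<in> infinite_words n"
  shows "prefix_word k w \<in> words n k"
  using assms by (auto simp: words_def infinite_words_def prefix_word_def PiE_iff simp del: upt_Suc)

lemma in_cylinder_prefix_word:
  assumes "w \<in> infinite_words n"
  shows "w \<in> cylinder n (prefix_word k w)"
  using assms by (simp add: cylinder_def)

lemma words_SucE:
  assumes "u \<in> words n (Suc k)"
  obtains v i where "u = v @ [i]" "v \<in> words n k" "i \<in> {1..n (Suc k)}"
proof -
  have "u \<noteq> []" using assms by (auto simp: words_def)
  then have "u = butlast u @ [last u]" by simp
  moreover have "butlast u \<in> words n k" "last u \<in> {1..n (Suc k)}"
    using assms \<open>u \<noteq> []\<close> by (auto simp: words_def nth_butlast last_conv_nth)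
  ultimately show ?thesis using that by blast
qed

lemma words_letter:
  assumes "u \<in> words n k" "1 \<le> j" "j \<le> k"
  shows "u ! (j - 1) \<in> {1..n j}"
  using assms by (cases j) (auto simp: words_def)

lemma finite_words_at: "finite (words n k)"
proof -
  have "words n k \<subseteq> {u. set u \<subseteq> (\<Union>j<k. {1..n (Suc j)}) \<and> length u = k}"
    by (auto simp: words_def in_set_conv_nth) blast+
  then show ?thesis by (rule finite_subset) (intro finite_lists_length_eq finite_UN_I; simp)
qed

lemma word_ratio_Nil [simp]: "word_ratio c [] = 1"
  by (simp add: word_ratio_def)

lemma word_ratio_append:
  "word_ratio c (u @ [i]) = word_ratio c u * c (Suc (length u)) i"
  by (simp add: word_ratio_def nth_append)

text \<open>Splits off the innermost map, the one indexed by the whole word, so that induction can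
  run by appending letters.\<close>

lemma word_map_append:
  "word_map S \<omega> (u @ [i]) = word_map S \<omega> u \<circ> factor_map S \<omega> (u @ [i])"
proof -
  have foldr_comp: "foldr (\<circ>) fs f = foldr (\<circ>) fs id \<circ> f" for fs :: "('a \<Rightarrow> 'a) list" and f
    by (induction fs) (auto simp: comp_assoc)
  \<comment> \<open>Prefixes of length at most \<open>length u\<close> do not see the new letter, so
    their factors agree.\<close>
  have "map (\<lambda>j. factor_map S \<omega> (take j (u @ [i]))) [1..<Suc (length u)] =
      map (\<lambda>j. factor_map S \<omega> (take j u)) [1..<Suc (length u)]"
    by (rule map_cong) auto
  then have "map (\<lambda>j. factor_map S \<omega> (take j (u @ [i]))) [1..<Suc (length (u @ [i]))] =
      map (\<lambda>j. factor_map S \<omega> (take j u)) [1..<Suc (length u)] @ [factor_map S \<omega> (u @ [i])]"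
    by simp
  then show ?thesis
    unfolding word_map_def by (simp del: upt_Suc add: foldr_comp[of _ "factor_map S \<omega> (u @ [i])"])
qed

text \<open>In this product form only finitely many coordinates are restricted, which shows openness
  in the product topology. Letter \<open>j\<close> sits at list position
  \<open>j - 1\<close>.\<close>

lemma cylinder_eq_PiE:
  assumes "u \<in> words n k"
  shows "cylinder n u = (\<Pi>\<^sub>E j\<in>{1..}. if j \<le> k then {u ! (j - 1)} else {1..n j})"
proof -
  have [simp]: "length u = k" using assms by (simp add: words_def)
  have "prefix_word k w = u \<longleftrightarrow> (\<forall>j\<in>{1..k}. w j = u ! (j - 1))" for w
  proof -
    have "prefix_word k w = u \<longleftrightarrow> (\<forall>j<k. w (Suc j) = u ! j)"
      by (simp add: list_eq_iff_nth_eq) (simp add: prefix_word_def del: upt_Suc)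
    also have "\<dots> \<longleftrightarrow> (\<forall>j\<in>Suc ` {..<k}. w j = u ! (j - 1))" by auto
    finally show ?thesis by (simp only: image_Suc_lessThan)
  qed
  moreover have "u ! (j - 1) \<in> {1..n j}" if "1 \<le> j" "j \<le> k" for j
    using words_letter[OF assms that] .
  ultimately have "w \<in> cylinder n u \<longleftrightarrow>
      w \<in> (\<Pi>\<^sub>E j\<in>{1..}. if j \<le> k then {u ! (j - 1)} else {1..n j})" for w
    by (auto simp: cylinder_def infinite_words_def PiE_iff Ball_def)
  then show ?thesis by blast
qed

lemma openin_cylinder:
  assumes "u \<in> words n k"
  shows "openin (word_topology n) (cylinder n u)"
proof -
  have "finite {j \<in> {1..}. (if j \<le> k then {u ! (j - 1)} else {1..n j}) \<noteq> topspace (discrete_topology {1..n j})}"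
    by (rule finite_subset[of _ "{..k}"]) auto
  moreover have "openin (discrete_topology {1..n j}) (if j \<le> k then {u ! (j - 1)} else {1..n j})"
    if "j \<ge> 1" for j
    using words_letter[OF assms] that by auto
  ultimately show ?thesis
    unfolding cylinder_eq_PiE[OF assms] word_topology_def by (simp add: openin_PiE_gen)
qed

lemma space_borel_words [simp]: "space (borel_words n) = infinite_words n"
  unfolding borel_words_def by (rule space_measure_of_conv)

lemma openin_in_borel_words:
  assumes "openin (word_topology n) U"
  shows "U \<in> sets (borel_words n)"
proof -
  have "{U. openin (word_topology n) U} \<subseteq> Pow (infinite_words n)"
    using openin_subset[of "word_topology n"] by (auto simp: word_topology_def infinite_words_def)
  then show ?thesis using assms by (simp add: borel_words_def)
qed


section \<open>Attractors with bounded contraction ratios\<close>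

text \<open>\<open>a\<close> and \<open>b\<close> are uniform bounds on the ratios; the theorem
  takes the infimum and the supremum for them.\<close>

locale bounded_ratio_attractor =
  fixes n :: "nat \<Rightarrow> nat"
    and J :: "(real ^ 'd) set"
    and S :: "nat \<Rightarrow> nat \<Rightarrow> real ^ 'd \<Rightarrow> real ^ 'd"
    and \<omega> :: "nat list \<Rightarrow> real ^ 'd"
    and JJ :: "nat list \<Rightarrow> (real ^ 'd) set"
    and c :: "nat \<Rightarrow> nat \<Rightarrow> real"
    and a b :: real
  assumes nonautonomous: "nonautonomous_structure n J S \<omega> JJ"
    and lipschitz: "\<And>k i x y. k \<ge> 1 \<Longrightarrow> i \<in> {1..n k} \<Longrightarrow> x \<in> J \<Longrightarrow> y \<in> J \<Longrightarrow>
      norm (S k i x - S k i y) \<le> c k i * norm (x - y)"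
    and a_pos: "0 < a" and b_less_1: "b < 1"
    and ratio_ge: "\<And>k i. k \<ge> 1 \<Longrightarrow> i \<in> {1..n k} \<Longrightarrow> a \<le> c k i"
    and ratio_le: "\<And>k i. k \<ge> 1 \<Longrightarrow> i \<in> {1..n k} \<Longrightarrow> c k i \<le> b"
begin

lemma words_in_finite_words: "u \<in> words n k \<Longrightarrow> u \<in> finite_words n"
  by (auto simp: finite_words_def)

lemma compact_J: "compact J" and J_nonempty: "J \<noteq> {}"
  using nonautonomous interior_subset[of J] unfolding nonautonomous_structure_def by auto

lemma b_pos: "0 < b"
proof -
  have "n 1 \<ge> 2" using nonautonomous by (auto simp: nonautonomous_structure_def)
  then show ?thesis using ratio_ge[of 1 1] ratio_le[of 1 1] a_pos by force
qed

section \<open>Ratios and diameters along words\<close>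

lemma word_ratio_pos:
  assumes "u \<in> words n k"
  shows "0 < word_ratio c u"
  unfolding word_ratio_def
proof (rule prod_pos)
  fix j assume "j \<in> {..<length u}"
  then show "0 < c (Suc j) (u ! j)"
    using assms ratio_ge[of "Suc j" "u ! j"] a_pos by (auto simp: words_def)
qed

lemma word_ratio_le_power:
  assumes "u \<in> words n k"
  shows "word_ratio c u \<le> b ^ k"
proof -
  have "word_ratio c u \<le> (\<Prod>j<length u. b)"
    unfolding word_ratio_def
  proof (rule prod_mono)
    fix j assume "j \<in> {..<length u}"
    then show "0 \<le> c (Suc j) (u ! j) \<and> c (Suc j) (u ! j) \<le> b"
      using assms ratio_ge[of "Suc j" "u ! j"] ratio_le[of "Suc j" "u ! j"] a_pos
      by (auto simp: words_def)
  qed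
  then show ?thesis using assms by (simp add: words_def)
qed

lemma factor_map_in_J:
  assumes "u \<in> words n (Suc k)" "x \<in> J"
  shows "factor_map S \<omega> u x \<in> J"
proof -
  have "u \<noteq> []" using assms by (auto simp: words_def)
  then have "factor_map S \<omega> u ` J \<subseteq> J"
    using nonautonomous words_in_finite_words[OF assms(1)] by (simp add: nonautonomous_structure_def)
  then show ?thesis using assms by auto
qed

text \<open>The last map is peeled off: its translation cancels in the difference, and its values
  stay in \<open>J\<close>, so the induction hypothesis applies to them.\<close>

lemma word_map_lipschitz:
  assumes "u \<in> words n k" "x \<in> J" "y \<in> J"
  shows "norm (word_map S \<omega> u x - word_map S \<omega> u y) \<le> word_ratio c u * norm (x - y)"
  using assms
proof (induction k arbitrary: u x y)
  case 0
  then have "u = []" by (simp add: words_def)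
  then show ?case by (simp add: word_map_def)
next
  case (Suc k)
  obtain v i where u: "u = v @ [i]" "v \<in> words n k" "i \<in> {1..n (Suc k)}"
    using Suc.prems(1) by (rule words_SucE)
  have [simp]: "length v = k" using u by (simp add: words_def)
  let ?f = "factor_map S \<omega> u"
  have "norm (word_map S \<omega> u x - word_map S \<omega> u y) \<le> word_ratio c v * norm (?f x - ?f y)"
    unfolding u(1) word_map_append comp_apply
    using Suc factor_map_in_J u by (intro Suc.IH) auto
  also have "\<dots> \<le> word_ratio c v * (c (Suc k) i * norm (x - y))"
  proof (rule mult_left_mono)
    show "norm (?f x - ?f y) \<le> c (Suc k) i * norm (x - y)"
      using lipschitz[of "Suc k" i x y] u Suc.prems by (simp add: factor_map_def)
  qed (use word_ratio_pos[OF u(2)] in simp)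
  finally show ?case by (simp add: u(1) word_ratio_append mult.assoc)
qed

lemma JJ_eq_image:
  assumes "u \<in> words n k"
  shows "JJ u = word_map S \<omega> u ` J"
  using nonautonomous words_in_finite_words[OF assms] by (simp add: nonautonomous_structure_def)

lemma diameter_JJ_le:
  assumes "u \<in> words n k" "x \<in> JJ u" "y \<in> JJ u"
  shows "norm (x - y) \<le> word_ratio c u * diameter J"
proof -
  obtain p p' where p: "x = word_map S \<omega> u p" "y = word_map S \<omega> u p'" "p \<in> J" "p' \<in> J"
    using assms JJ_eq_image by auto
  have "norm (x - y) \<le> word_ratio c u * norm (p - p')"
    using word_map_lipschitz assms p by simp
  also have "\<dots> \<le> word_ratio c u * diameter J"
    using word_ratio_pos[OF assms(1)] diameter_bounded_bound[OF compact_imp_bounded[OF compact_J] p(3,4)]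
    by (intro mult_left_mono) (auto simp: dist_norm)
  finally show ?thesis .
qed

lemma diameter_J_nonneg: "diameter J \<ge> 0"
  using compact_J by (intro diameter_ge_0 compact_imp_bounded)

lemma closed_JJ: "closed (JJ u)" and JJ_subset_J: "JJ u \<subseteq> J" if "u \<in> words n k"
proof -
  have "\<forall>u\<in>finite_words n. closed (JJ u) \<and> JJ u \<subseteq> J"
    using nonautonomous unfolding nonautonomous_structure_def by (elim conjE)
  then show "closed (JJ u)" "JJ u \<subseteq> J" using words_in_finite_words[OF that] by auto
qed

lemma compact_JJ:
  assumes "u \<in> words n k"
  shows "compact (JJ u)"
  using compact_Int_closed[OF compact_J closed_JJ[OF assms]] JJ_subset_J[OF assms]
  by (simp add: inf.absorb2)

lemma JJ_append_subset:
  assumes "u \<in> words n k" "i \<in> {1..n (Suc k)}"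
  shows "JJ (u @ [i]) \<subseteq> JJ u"
proof -
  have "\<forall>k\<ge>1. \<forall>u\<in>words n (k - 1). \<forall>i\<in>{1..n k}. JJ (u @ [i]) \<subseteq> JJ u"
    using nonautonomous by (simp add: nonautonomous_structure_def)
  from this[rule_format, of "Suc k" u i] show ?thesis using assms by simp
qed

section \<open>The projection\<close>

text \<open>Nested nonempty compact sets have a common point, and diameters of order
  \<open>b ^ k\<close> make it unique, so the description in \<open>projection\<close> denotes
  it.\<close>

lemma projection_in_JJ:
  assumes w: "w \<in> infinite_words n"
  shows "projection JJ w \<in> JJ (prefix_word k w)"
proof -
  let ?F = "\<lambda>k. JJ (prefix_word k w)"
  have word: "prefix_word k w \<in> words n k" for k using w by (rule prefix_word_in_words)
  have step: "?F (Suc k) \<subseteq> ?F k" for k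
  proof -
    have "w (Suc k) \<in> {1..n (Suc k)}" using w by (auto simp: infinite_words_def PiE_iff)
    then show ?thesis using JJ_append_subset[OF word] by (simp add: prefix_word_Suc)
  qed
  have anti: "?F m \<subseteq> ?F k" if "k \<le> m" for k m
    using lift_Suc_antimono_le[of ?F, OF step that] .
  have "?F 0 = J" using nonautonomous by (simp add: nonautonomous_structure_def)
  have "\<Inter>(range ?F) \<noteq> {}"
    using compact_JJ[OF word] JJ_eq_image[OF word] J_nonempty anti by (intro compact_nest) auto
  then obtain x where x: "\<And>k. x \<in> ?F k" by blast
  have "projection JJ w = x"
    unfolding projection_def
  proof (rule the_equality)
    show "x \<in> (\<Inter>k\<in>{1..}. ?F k)" using x by auto
    fix y assume y: "y \<in> (\<Inter>k\<in>{1..}. ?F k)"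
    have "norm (y - x) \<le> b ^ k * diameter J" if "k \<ge> 1" for k
    proof -
      have "norm (y - x) \<le> word_ratio c (prefix_word k w) * diameter J"
        using y x that by (intro diameter_JJ_le[OF word]) auto
      also have "\<dots> \<le> b ^ k * diameter J"
        using word_ratio_le_power[OF word] diameter_J_nonneg by (intro mult_right_mono) auto
      finally show ?thesis .
    qed
    moreover have "(\<lambda>k. b ^ k * diameter J) \<longlonglongrightarrow> 0 * diameter J"
      using b_pos b_less_1 by (intro tendsto_mult LIMSEQ_power_zero tendsto_const) auto
    ultimately have "norm (y - x) \<le> 0 * diameter J"
      by (intro tendsto_lowerbound[where F = sequentially]) (auto simp: eventually_sequentially)
    then show "y = x" by simp
  qed
  then show ?thesis using x by simp
qed

lemma projection_in_J: "w \<in> infinite_words n \<Longrightarrow> projection JJ w \<in> J"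
  using projection_in_JJ[of w 0] nonautonomous by (simp add: nonautonomous_structure_def)

lemma projection_cylinder:
  assumes "w \<in> cylinder n u"
  shows "projection JJ w \<in> JJ u"
  using assms projection_in_JJ[of w "length u"] by (simp add: cylinder_def)

text \<open>In fact the projection is continuous: the preimage of an open \<open>U\<close> is the
  union of the cylinders whose sets \<open>JJ u\<close> lie in \<open>U\<close>, hence open.\<close>

lemma projection_measurable: "projection JJ \<in> borel_measurable (borel_words n)"
proof (rule borel_measurableI)
  fix U :: "(real ^ 'd) set" assume U: "open U"
  have "projection JJ -` U \<inter> infinite_words n = \<Union>{cylinder n u | u k. u \<in> words n k \<and> JJ u \<subseteq> U}"
  proof (intro equalityI subsetI)
    fix w assume "w \<in> projection JJ -` U \<inter> infinite_words n"
    then have w: "w \<in> infinite_words n" "projection JJ w \<in> U" by auto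
    obtain e where e: "e > 0" "ball (projection JJ w) e \<subseteq> U"
      using U w open_contains_ball by metis
    have "(\<lambda>k. b ^ k * diameter J) \<longlonglongrightarrow> 0 * diameter J"
      using b_pos b_less_1 by (intro tendsto_mult LIMSEQ_power_zero tendsto_const) auto
    then have "\<forall>\<^sub>F k in sequentially. b ^ k * diameter J < e"
      using e by (auto dest: order_tendstoD)
    then obtain k where k: "b ^ k * diameter J < e" by (auto simp: eventually_sequentially)
    have word: "prefix_word k w \<in> words n k" using w by (simp add: prefix_word_in_words)
    have "JJ (prefix_word k w) \<subseteq> ball (projection JJ w) e"
    proof
      fix y assume "y \<in> JJ (prefix_word k w)"
      then have "norm (projection JJ w - y) \<le> word_ratio c (prefix_word k w) * diameter J"
        using projection_in_JJ w by (intro diameter_JJ_le[OF word]) auto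
      also have "\<dots> \<le> b ^ k * diameter J"
        using word_ratio_le_power[OF word] diameter_J_nonneg by (intro mult_right_mono) auto
      finally show "y \<in> ball (projection JJ w) e" using k by (simp add: dist_norm)
    qed
    then show "w \<in> \<Union>{cylinder n u | u k. u \<in> words n k \<and> JJ u \<subseteq> U}"
      using e word in_cylinder_prefix_word[OF w(1)] by blast
  next
    fix w assume "w \<in> \<Union>{cylinder n u | u k. u \<in> words n k \<and> JJ u \<subseteq> U}"
    then show "w \<in> projection JJ -` U \<inter> infinite_words n"
      using projection_cylinder by (auto simp: cylinder_def)
  qed
  moreover have "openin (word_topology n) (\<Union>{cylinder n u | u k. u \<in> words n k \<and> JJ u \<subseteq> U})"
    by (rule openin_Union) (auto intro: openin_cylinder)
  ultimately show "projection JJ -` U \<inter> space (borel_words n) \<in> sets (borel_words n)"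
    by (simp add: openin_in_borel_words)
qed

section \<open>The cut set and its partition of the word space\<close>

text \<open>A cut word overshoots \<open>r\<close> by one letter only: its parent has ratio above
  \<open>r\<close>, and the last letter contributes a factor of at least \<open>a\<close>.\<close>

lemma cut_setE:
  assumes "u \<in> cut_set n c r"
  obtains k where "u \<in> words n (Suc k)" "word_ratio c u \<le> r" "r * a \<le> word_ratio c u"
    "r < word_ratio c (butlast u)" "butlast u \<in> words n k"
proof -
  obtain m where m: "u \<in> words n m" "u \<noteq> []" "word_ratio c u \<le> r" "r < word_ratio c (butlast u)"
    using assms by (auto simp: cut_set_def finite_words_def)
  then obtain k where "m = Suc k" by (cases m) (auto simp: words_def)
  then obtain v i where u: "u = v @ [i]" "v \<in> words n k" "i \<in> {1..n (Suc k)}"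
    using m words_SucE by metis
  have [simp]: "length v = k" using u by (simp add: words_def)
  have "r * a \<le> word_ratio c v * c (Suc k) i"
    using m u ratio_ge[of "Suc k" i] a_pos word_ratio_pos[OF u(2)] by (intro mult_mono) auto
  then show ?thesis using that[of k] m u \<open>m = Suc k\<close> by (simp add: word_ratio_append)
qed

text \<open>The parent of a cut word has ratio above \<open>r\<close>, yet at most
  \<open>b ^ k\<close> at length \<open>k\<close>, which bounds the length.\<close>

lemma finite_cut_set:
  assumes "r > 0"
  shows "finite (cut_set n c r)"
proof -
  obtain k0 where k0: "b ^ k0 < r" using real_arch_pow_inv[OF assms b_less_1] by auto
  have "cut_set n c r \<subseteq> (\<Union>k\<le>Suc k0. words n k)"
  proof
    fix u assume "u \<in> cut_set n c r"
    then obtain k where k: "u \<in> words n (Suc k)" "r < word_ratio c (butlast u)" "butlast u \<in> words n k"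
      by (rule cut_setE)
    have "b ^ k0 < b ^ k" using k0 k word_ratio_le_power[OF k(3)] by simp
    then have "k < k0" using b_pos b_less_1 power_decreasing[of k0 k b] by (meson leI not_le less_imp_le)
    then show "u \<in> (\<Union>k\<le>Suc k0. words n k)" using k by auto
  qed
  then show ?thesis by (rule finite_subset) (auto simp: finite_words_at)
qed

text \<open>The cut word of \<open>w\<close> is its shortest prefix with ratio at most
  \<open>r\<close>. It is nonempty because \<open>r < 1\<close>, and minimality controls its
  parent.\<close>

lemma cylinder_cut_set_covers:
  assumes w: "w \<in> infinite_words n" and r: "0 < r" "r < 1"
  shows "\<exists>u\<in>cut_set n c r. w \<in> cylinder n u"
proof -
  let ?P = "\<lambda>k. word_ratio c (prefix_word k w) \<le> r"
  have word: "prefix_word k w \<in> words n k" for k using w by (rule prefix_word_in_words)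
  obtain k0 where "b ^ k0 < r" using real_arch_pow_inv[OF r(1) b_less_1] by auto
  then have "?P k0" using word_ratio_le_power[OF word[of k0]] by simp
  define k where "k = (LEAST k. ?P k)"
  have "?P k" unfolding k_def using \<open>?P k0\<close> by (rule LeastI)
  then have "k \<noteq> 0" using r by (intro notI) simp
  then obtain m where m: "k = Suc m" by (cases k) auto
  have "\<not> ?P m" using not_less_Least[of m ?P] m by (simp add: k_def)
  then have "prefix_word k w \<in> cut_set n c r"
    using \<open>?P k\<close> word[of k] words_in_finite_words unfolding m by (simp add: cut_set_def prefix_word_Suc)
  then show ?thesis using in_cylinder_prefix_word[OF w] by blast
qed

text \<open>Ratios do not increase along the prefixes of a common \<open>w\<close>. A strictly
  shorter cut word, of ratio at most \<open>r\<close>, would be a prefix of the other's parent,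
  whose ratio exceeds \<open>r\<close>.\<close>

lemma cylinder_cut_set_disjoint:
  assumes "u \<in> cut_set n c r" "u' \<in> cut_set n c r" "u \<noteq> u'"
  shows "cylinder n u \<inter> cylinder n u' = {}"
proof -
  have False if "v \<in> cut_set n c r" "v' \<in> cut_set n c r" "length v < length v'"
    "w \<in> cylinder n v" "w \<in> cylinder n v'" for v v' w
  proof -
    have w: "w \<in> infinite_words n" and v: "prefix_word (length v) w = v" "prefix_word (length v') w = v'"
      using that by (auto simp: cylinder_def)
    let ?f = "\<lambda>k. word_ratio c (prefix_word k w)"
    have step: "?f (Suc k) \<le> ?f k" for k
    proof -
      have "w (Suc k) \<in> {1..n (Suc k)}" using w by (auto simp: infinite_words_def PiE_iff)
      then have "c (Suc k) (w (Suc k)) \<le> 1" using ratio_le[of "Suc k" "w (Suc k)"] b_less_1 by simp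
      then show ?thesis using word_ratio_pos[OF prefix_word_in_words[OF w, of k]]
        by (simp add: prefix_word_Suc word_ratio_append mult_left_le)
    qed
    obtain m where m: "length v' = Suc m" using \<open>length v < length v'\<close> by (cases "length v'") auto
    then have "?f m \<le> ?f (length v)"
      using lift_Suc_antimono_le[of ?f, OF step, of "length v" m] \<open>length v < length v'\<close> by simp
    moreover have "butlast v' = prefix_word m w"
      using v(2) m prefix_word_Suc[of m w] by (metis butlast_snoc)
    ultimately show False using that v by (auto simp: cut_set_def)
  qed
  moreover have "length u \<noteq> length u'" if "w \<in> cylinder n u" "w \<in> cylinder n u'" for w
    using that assms by (auto simp: cylinder_def)
  ultimately show ?thesis using assms by (metis disjoint_iff linorder_neqE_nat)
qed

end


section \<open>Measures on the words\<close>

lemma eventually_unit_interval: "\<forall>\<^sub>F r in at_right 0. 0 < r \<and> r < (1::real)"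
  by (auto simp: eventually_at_right_field intro: exI[of _ 1])

text \<open>The divisor \<open>ln r\<close> is negative, so a lower bound on the numerator becomes
  an upper bound on the quotient.\<close>

lemma divide_ln_le:
  fixes r :: real
  assumes "0 < r" "r < 1" "s * ln r - C \<le> y"
  shows "y / ln r \<le> s + C / (- ln r)"
proof -
  have "ln r < 0" using assms by simp
  then have "y / ln r \<le> (s * ln r - C) / ln r" using assms by (intro divide_right_mono_neg) auto
  also have "\<dots> = s + C / (- ln r)" using \<open>ln r < 0\<close> by (simp add: diff_divide_distrib)
  finally show ?thesis .
qed

locale bounded_ratio_attractor_measure =
  bounded_ratio_attractor n J S \<omega> JJ c a b + finite_measure \<mu>
  for n :: "nat \<Rightarrow> nat"
    and J :: "(real ^ 'd) set"
    and S :: "nat \<Rightarrow> nat \<Rightarrow> real ^ 'd \<Rightarrow> real ^ 'd"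
    and \<omega> :: "nat list \<Rightarrow> real ^ 'd"
    and JJ :: "nat list \<Rightarrow> (real ^ 'd) set"
    and c :: "nat \<Rightarrow> nat \<Rightarrow> real"
    and a b :: real
    and \<mu> :: "(nat \<Rightarrow> nat) measure" +
  assumes sets_mu: "sets \<mu> = sets (borel_words n)"
    and positive: "measure \<mu> (space \<mu>) > 0"
begin

section \<open>Joint masses of cylinders and cubes\<close>

abbreviation "\<nu> \<equiv> image_measure JJ \<mu>"

text \<open>The entries for the marginal inequalities: cylinder masses are the row sums, cube masses
  the column sums.\<close>

definition mass :: "nat list \<Rightarrow> (real ^ 'd) set \<Rightarrow> real" where
  "mass u Q = measure \<mu> (projection JJ -` Q \<inter> cylinder n u)"

text \<open>For \<open>r > 0\<close> these are finitely many and carry all the mass, since the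
  projection takes values in \<open>J\<close>.\<close>

definition cubes :: "real \<Rightarrow> (real ^ 'd) set set" where
  "cubes r = {Q \<in> mesh r. Q \<inter> J \<noteq> {}}"

text \<open>The count from \<open>card_mesh_meeting\<close> at \<open>L = r * diameter J\<close>,
  where \<open>r\<close> cancels.\<close>

definition K :: real where
  "K = (2 * diameter J + 3) ^ CARD('d)"

definition M :: real where
  "M = measure \<mu> (space \<mu>)"

lemma K_pos: "K > 0"
  unfolding K_def using diameter_J_nonneg by (intro zero_less_power) simp

lemma M_pos: "M > 0"
  using positive by (simp add: M_def)

lemma space_mu: "space \<mu> = infinite_words n"
  using sets_eq_imp_space_eq[OF sets_mu] by simp

lemma projection_measurable_mu: "projection JJ \<in> borel_measurable \<mu>"
  using projection_measurable measurable_cong_sets[OF sets_mu refl] by blast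

lemma measure_image:
  assumes "Q \<in> sets borel"
  shows "measure \<nu> Q = measure \<mu> (projection JJ -` Q \<inter> infinite_words n)"
  unfolding image_measure_def using measure_distr[OF projection_measurable_mu assms] space_mu by simp

lemma vimage_projection_in_sets:
  assumes "Q \<in> sets borel"
  shows "projection JJ -` Q \<inter> infinite_words n \<in> sets \<mu>"
  using measurable_sets[OF projection_measurable_mu assms] space_mu by simp

lemma cylinder_in_sets:
  assumes "u \<in> finite_words n"
  shows "cylinder n u \<in> sets \<mu>"
  using assms openin_in_borel_words[OF openin_cylinder] sets_mu by (auto simp: finite_words_def)

lemma cut_set_finite_words: "u \<in> cut_set n c r \<Longrightarrow> u \<in> finite_words n"
  by (simp add: cut_set_def)

lemma cylinder_subset: "cylinder n u \<subseteq> infinite_words n"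
  by (auto simp: cylinder_def)

lemma piece_in_sets:
  assumes "u \<in> finite_words n" "Q \<in> sets borel"
  shows "projection JJ -` Q \<inter> cylinder n u \<in> sets \<mu>"
proof -
  have "projection JJ -` Q \<inter> cylinder n u = (projection JJ -` Q \<inter> infinite_words n) \<inter> cylinder n u"
    using cylinder_subset by blast
  then show ?thesis
    using sets.Int[OF vimage_projection_in_sets[OF assms(2)] cylinder_in_sets[OF assms(1)]] by simp
qed

lemma cubes_in_borel: "Q \<in> cubes r \<Longrightarrow> Q \<in> sets borel"
  by (auto simp: cubes_def intro: mesh_in_borel)

lemma finite_cubes:
  assumes "r > 0"
  shows "finite (cubes r)"
  unfolding cubes_def
proof (rule card_mesh_meeting(1)[OF assms diameter_J_nonneg])
  show "norm (x - y) \<le> diameter J" if "x \<in> J" "y \<in> J" for x y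
    using diameter_bounded_bound[OF compact_imp_bounded[OF compact_J] that] by (simp add: dist_norm)
qed

lemma card_cubes_le:
  assumes "0 < r" "r < 1"
  shows "real (card (cubes r)) \<le> K / r ^ CARD('d)"
proof -
  have "real (card (cubes r)) \<le> (2 * diameter J / r + 3) ^ CARD('d)"
    unfolding cubes_def
  proof (rule card_mesh_meeting(2)[OF assms(1) diameter_J_nonneg])
    show "norm (x - y) \<le> diameter J" if "x \<in> J" "y \<in> J" for x y
      using diameter_bounded_bound[OF compact_imp_bounded[OF compact_J] that] by (simp add: dist_norm)
  qed
  also have "\<dots> \<le> ((2 * diameter J + 3) / r) ^ CARD('d)"
    using assms diameter_J_nonneg by (intro power_mono) (auto simp: field_simps)
  finally show ?thesis by (simp add: K_def power_divide)
qed

text \<open>A cube with nonzero joint mass meets \<open>JJ u\<close>, whose diameter is at most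
  \<open>r * diameter J\<close> because a cut word has ratio at most \<open>r\<close>.\<close>

lemma card_mass_le:
  assumes "0 < r" "u \<in> cut_set n c r"
  shows "real (card {Q \<in> cubes r. mass u Q \<noteq> 0}) \<le> K"
proof -
  obtain k where u: "u \<in> words n (Suc k)" "word_ratio c u \<le> r" using assms(2) by (rule cut_setE)
  have diam: "norm (x - y) \<le> r * diameter J" if "x \<in> JJ u" "y \<in> JJ u" for x y
    using diameter_JJ_le[OF u(1) that] mult_right_mono[OF u(2) diameter_J_nonneg] by simp
  have "{Q \<in> cubes r. mass u Q \<noteq> 0} \<subseteq> {Q \<in> mesh r. Q \<inter> JJ u \<noteq> {}}"
  proof clarify
    fix Q assume Q: "Q \<in> cubes r" "mass u Q \<noteq> 0"
    then have "projection JJ -` Q \<inter> cylinder n u \<noteq> {}" by (auto simp: mass_def)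
    then obtain w where w: "projection JJ w \<in> Q" "w \<in> cylinder n u" by auto
    then have "projection JJ w \<in> Q \<inter> JJ u" using projection_cylinder by simp
    then show "Q \<in> mesh r \<and> Q \<inter> JJ u \<noteq> {}" using Q by (auto simp: cubes_def)
  qed
  then have "real (card {Q \<in> cubes r. mass u Q \<noteq> 0}) \<le> real (card {Q \<in> mesh r. Q \<inter> JJ u \<noteq> {}})"
    using card_mesh_meeting(1)[OF assms(1) _ diam] assms(1) diameter_J_nonneg
    by (intro of_nat_mono card_mono) auto
  also have "\<dots> \<le> (2 * (r * diameter J) / r + 3) ^ CARD('d)"
    using card_mesh_meeting(2)[OF assms(1) _ diam] assms(1) diameter_J_nonneg by simp
  finally show ?thesis using assms(1) by (simp add: K_def)
qed

lemma sum_mass_cubes: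
  assumes "0 < r" "u \<in> finite_words n"
  shows "(\<Sum>Q\<in>cubes r. mass u Q) = measure \<mu> (cylinder n u)"
proof -
  have "(\<Union>Q\<in>cubes r. projection JJ -` Q \<inter> cylinder n u) = cylinder n u"
  proof (intro equalityI subsetI)
    fix w assume w: "w \<in> cylinder n u"
    obtain Q where "Q \<in> mesh r" "projection JJ w \<in> Q" using mesh_covers[OF assms(1)] by blast
    moreover have "projection JJ w \<in> J" using w cylinder_subset projection_in_J by blast
    ultimately show "w \<in> (\<Union>Q\<in>cubes r. projection JJ -` Q \<inter> cylinder n u)"
      using w by (auto simp: cubes_def)
  qed auto
  moreover have "measure \<mu> (\<Union>Q\<in>cubes r. projection JJ -` Q \<inter> cylinder n u) =
      (\<Sum>Q\<in>cubes r. measure \<mu> (projection JJ -` Q \<inter> cylinder n u))"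
  proof (rule finite_measure_finite_Union)
    show "finite (cubes r)" using assms(1) by (rule finite_cubes)
    show "(\<lambda>Q. projection JJ -` Q \<inter> cylinder n u) ` cubes r \<subseteq> sets \<mu>"
      using piece_in_sets[OF assms(2)] cubes_in_borel by auto
    show "disjoint_family_on (\<lambda>Q. projection JJ -` Q \<inter> cylinder n u) (cubes r)"
      using mesh_disjoint[OF assms(1)] by (fastforce simp: disjoint_family_on_def cubes_def)
  qed
  ultimately show ?thesis by (simp add: mass_def)
qed

text \<open>The cylinders of the cut set partition the word space; that they cover it uses
  \<open>r < 1\<close>.\<close>

lemma sum_mass_cut_set:
  assumes "0 < r" "r < 1" "Q \<in> cubes r"
  shows "(\<Sum>u\<in>cut_set n c r. mass u Q) = measure \<nu> Q"
proof -
  have "(\<Union>u\<in>cut_set n c r. projection JJ -` Q \<inter> cylinder n u) = projection JJ -` Q \<inter> infinite_words n"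
    using cylinder_cut_set_covers[OF _ assms(1,2)] cylinder_subset by blast
  moreover have "measure \<mu> (\<Union>u\<in>cut_set n c r. projection JJ -` Q \<inter> cylinder n u) =
      (\<Sum>u\<in>cut_set n c r. measure \<mu> (projection JJ -` Q \<inter> cylinder n u))"
  proof (rule finite_measure_finite_Union)
    show "finite (cut_set n c r)" using assms(1) by (rule finite_cut_set)
    show "(\<lambda>u. projection JJ -` Q \<inter> cylinder n u) ` cut_set n c r \<subseteq> sets \<mu>"
      using piece_in_sets cut_set_finite_words cubes_in_borel[OF assms(3)] by auto
    show "disjoint_family_on (\<lambda>u. projection JJ -` Q \<inter> cylinder n u) (cut_set n c r)"
      using cylinder_cut_set_disjoint by (fastforce simp: disjoint_family_on_def)
  qed
  ultimately show ?thesis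
    using measure_image[OF cubes_in_borel[OF assms(3)]] by (simp add: mass_def)
qed

lemma sum_measure_cubes:
  assumes "0 < r"
  shows "(\<Sum>Q\<in>cubes r. measure \<nu> Q) = M"
proof -
  \<comment> \<open>The cylinder of the empty word is the whole word space, so the total mass is a
    row sum.\<close>
  have "[] \<in> finite_words n" by (auto simp: finite_words_def words_def)
  moreover have "cylinder n [] = infinite_words n" by (simp add: cylinder_def)
  ultimately have "(\<Sum>Q\<in>cubes r. mass [] Q) = M"
    using sum_mass_cubes[OF assms, of "[]"] by (simp add: M_def space_mu)
  moreover have "mass [] Q = measure \<nu> Q" if "Q \<in> cubes r" for Q
    using measure_image[OF cubes_in_borel[OF that]] \<open>cylinder n [] = infinite_words n\<close>
    by (simp add: mass_def)
  ultimately show ?thesis by simp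
qed

lemma sum_measure_cylinders:
  assumes "0 < r" "r < 1"
  shows "(\<Sum>u\<in>cut_set n c r. measure \<mu> (cylinder n u)) = M"
proof -
  have "(\<Sum>u\<in>cut_set n c r. measure \<mu> (cylinder n u)) = (\<Sum>u\<in>cut_set n c r. \<Sum>Q\<in>cubes r. mass u Q)"
    using sum_mass_cubes[OF assms(1)] cut_set_finite_words by (intro sum.cong) auto
  also have "\<dots> = (\<Sum>Q\<in>cubes r. \<Sum>u\<in>cut_set n c r. mass u Q)" by (rule sum.swap)
  finally show ?thesis using sum_mass_cut_set[OF assms] sum_measure_cubes[OF assms(1)] by simp
qed

lemma measure_image_outside:
  assumes "Q \<in> mesh r" "Q \<notin> cubes r"
  shows "measure \<nu> Q = 0"
proof -
  have "projection JJ -` Q \<inter> infinite_words n = {}"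
    using assms projection_in_J by (auto simp: cubes_def)
  then show ?thesis using measure_image[OF mesh_in_borel[OF assms(1)]] by simp
qed

text \<open>Outside \<open>cubes r\<close> the measure vanishes and \<open>g 0 = 0\<close>, so the
  infinite \<open>ereal\<close> sum becomes a finite real one.\<close>

lemma infsum_mesh:
  assumes "r > 0" "g 0 = 0"
  shows "(\<Sum>\<^sub>\<infinity>Q\<in>mesh r. ereal (g (measure \<nu> Q))) = ereal (\<Sum>Q\<in>cubes r. g (measure \<nu> Q))"
proof -
  have "(\<Sum>\<^sub>\<infinity>Q\<in>mesh r. ereal (g (measure \<nu> Q))) = (\<Sum>\<^sub>\<infinity>Q\<in>cubes r. ereal (g (measure \<nu> Q)))"
    using measure_image_outside assms(2)
    by (intro infsum_cong_neutral) (auto simp: zero_ereal_def cubes_def)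
  then show ?thesis using finite_cubes[OF assms(1)] by simp
qed

text \<open>Positive total mass keeps the argument of the logarithm positive, so that
  \<open>ln_ereal\<close> agrees with \<open>ln\<close>.\<close>

lemma sum_powr_cubes_pos:
  assumes "r > 0"
  shows "(\<Sum>Q\<in>cubes r. measure \<nu> Q powr q) > 0"
proof -
  have "\<exists>Q\<in>cubes r. measure \<nu> Q \<noteq> 0"
    using sum_measure_cubes[OF assms] M_pos by (metis less_irrefl sum.neutral)
  then obtain Q where "Q \<in> cubes r" "measure \<nu> Q \<noteq> 0" by blast
  then show ?thesis using finite_cubes[OF assms] by (intro sum_pos2[of _ Q]) auto
qed

lemma dim_quotient_eq:
  assumes "0 < r" "r < 1" "q \<noteq> 1"
  shows "dim_quotient \<nu> q r = ereal (ln (\<Sum>Q\<in>cubes r. measure \<nu> Q powr q) / (q - 1) / ln r)"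
proof -
  have "(q - 1) * ln r \<noteq> 0" using assms by simp
  moreover have "(\<Sum>\<^sub>\<infinity>Q\<in>mesh r. ereal (measure \<nu> Q powr q)) = ereal (\<Sum>Q\<in>cubes r. measure \<nu> Q powr q)"
    using assms(1) by (rule infsum_mesh) simp
  ultimately show ?thesis
    using assms sum_powr_cubes_pos[OF assms(1), of q]
    by (simp add: dim_quotient_def ln_ereal_def zero_ereal_def)
qed

text \<open>Dividing by \<open>q - 1\<close> first leaves only the sign of \<open>ln r\<close> to
  handle, so one criterion serves both sides of \<open>q = 1\<close>.\<close>

lemma dim_quotient_leI:
  assumes "0 < r" "r < 1" "q \<noteq> 1"
    and "s * ln r - C \<le> ln (\<Sum>Q\<in>cubes r. measure \<nu> Q powr q) / (q - 1)"
  shows "dim_quotient \<nu> q r \<le> ereal (s + C / (- ln r))"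
  unfolding dim_quotient_eq[OF assms(1-3)] ereal_less_eq(3) using assms by (intro divide_ln_le)

lemma dim_quotient_1_eq:
  assumes "0 < r" "r < 1"
  shows "dim_quotient \<nu> 1 r = ereal ((\<Sum>Q\<in>cubes r. measure \<nu> Q * ln (measure \<nu> Q)) / ln r)"
proof -
  have "(\<Sum>\<^sub>\<infinity>Q\<in>mesh r. ereal (measure \<nu> Q * ln (measure \<nu> Q))) =
      ereal (\<Sum>Q\<in>cubes r. measure \<nu> Q * ln (measure \<nu> Q))"
    using assms(1) by (rule infsum_mesh) simp
  then show ?thesis using assms by (simp add: dim_quotient_def)
qed

section \<open>Comparison of cylinder sums with cube sums\<close>

lemma sum_cylinder_powr_le:
  assumes "0 < r" "r < 1" "q \<ge> 1"
  shows "(\<Sum>u\<in>cut_set n c r. measure \<mu> (cylinder n u) powr q)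
    \<le> K powr (q - 1) * (\<Sum>Q\<in>cubes r. measure \<nu> Q powr q)"
proof -
  have "(\<Sum>u\<in>cut_set n c r. (\<Sum>Q\<in>cubes r. mass u Q) powr q)
      \<le> K powr (q - 1) * (\<Sum>Q\<in>cubes r. (\<Sum>u\<in>cut_set n c r. mass u Q) powr q)"
    using assms finite_cut_set finite_cubes K_pos card_mass_le
    by (intro sum_marginal_powr_le) (auto simp: mass_def)
  then show ?thesis
    using sum_mass_cubes[OF assms(1) cut_set_finite_words] sum_mass_cut_set[OF assms(1,2)] by simp
qed

lemma sum_cylinder_powr_ge:
  assumes "0 < r" "r < 1" "0 < q" "q < 1"
  shows "(\<Sum>Q\<in>cubes r. measure \<nu> Q powr q)
    \<le> K powr (1 - q) * (\<Sum>u\<in>cut_set n c r. measure \<mu> (cylinder n u) powr q)"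
proof -
  have "(\<Sum>Q\<in>cubes r. (\<Sum>u\<in>cut_set n c r. mass u Q) powr q)
      \<le> K powr (1 - q) * (\<Sum>u\<in>cut_set n c r. (\<Sum>Q\<in>cubes r. mass u Q) powr q)"
    using assms finite_cut_set finite_cubes K_pos card_mass_le
    by (intro sum_marginal_powr_ge) (auto simp: mass_def)
  then show ?thesis
    using sum_mass_cubes[OF assms(1) cut_set_finite_words] sum_mass_cut_set[OF assms(1,2)] by simp
qed

lemma sum_cylinder_mult_ln_le:
  assumes "0 < r" "r < 1"
  shows "(\<Sum>u\<in>cut_set n c r. measure \<mu> (cylinder n u) * ln (measure \<mu> (cylinder n u))) - M * ln K
    \<le> (\<Sum>Q\<in>cubes r. measure \<nu> Q * ln (measure \<nu> Q))"
proof -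
  have "(\<Sum>u\<in>cut_set n c r. (\<Sum>Q\<in>cubes r. mass u Q) * ln (\<Sum>Q\<in>cubes r. mass u Q))
        - (\<Sum>u\<in>cut_set n c r. \<Sum>Q\<in>cubes r. mass u Q) * ln K
      \<le> (\<Sum>Q\<in>cubes r. (\<Sum>u\<in>cut_set n c r. mass u Q) * ln (\<Sum>u\<in>cut_set n c r. mass u Q))"
    using assms finite_cut_set finite_cubes K_pos card_mass_le
    by (intro sum_marginal_mult_ln_le) (auto simp: mass_def)
  then show ?thesis
    using sum_mass_cubes[OF assms(1) cut_set_finite_words] sum_mass_cut_set[OF assms]
      sum_measure_cylinders[OF assms] by simp
qed

section \<open>Bounds on the dimension quotient from the cut sums\<close>

text \<open>Up to a constant, the cut sum is at most \<open>r powr (s * (1 - q))\<close> times the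
  cube sum. A lower bound 1 on it therefore bounds the cube sum from below, and logarithms give the
  claim.\<close>

lemma dim_quotient_le_gt_1:
  assumes r: "0 < r" "r < 1" and "q > 1" "s \<ge> 0" and F: "1 \<le> cut_sum n c \<mu> q s r"
  shows "dim_quotient \<nu> q r \<le> ereal (s + (ln K - s * ln a) / (- ln r))"
proof -
  let ?P = "\<Sum>u\<in>cut_set n c r. measure \<mu> (cylinder n u) powr q"
  let ?X = "\<Sum>Q\<in>cubes r. measure \<nu> Q powr q"
  \<comment> \<open>The exponent \<open>s * (1 - q)\<close> is nonpositive, so the lower bound
    \<open>r * a\<close> on the ratio bounds the power from above.\<close>
  have "cut_sum n c \<mu> q s r \<le>
      (\<Sum>u\<in>cut_set n c r. (r * a) powr (s * (1 - q)) * measure \<mu> (cylinder n u) powr q)"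
    unfolding cut_sum_def using assms a_pos
    by (auto intro!: sum_mono mult_right_mono powr_mono2' mult_nonneg_nonpos elim!: cut_setE)
  also have "\<dots> = (r * a) powr (s * (1 - q)) * ?P" by (simp add: sum_distrib_left)
  also have "\<dots> \<le> (r * a) powr (s * (1 - q)) * (K powr (q - 1) * ?X)"
    using assms by (intro mult_left_mono sum_cylinder_powr_le) auto
  finally have "1 \<le> (r * a) powr (s * (1 - q)) * (K powr (q - 1) * ?X)" using F by simp
  then have "0 \<le> ln ((r * a) powr (s * (1 - q)) * (K powr (q - 1) * ?X))" by simp
  also have "\<dots> = s * (1 - q) * (ln r + ln a) + ((q - 1) * ln K + ln ?X)"
    using r a_pos K_pos sum_powr_cubes_pos[OF r(1), of q] by (simp add: ln_mult ln_powr)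
  finally have "(q - 1) * (s * ln r - (ln K - s * ln a)) \<le> ln ?X" by (simp add: algebra_simps)
  then have "s * ln r - (ln K - s * ln a) \<le> ln ?X / (q - 1)"
    using \<open>q > 1\<close> by (simp add: pos_le_divide_eq mult.commute)
  then show ?thesis using r \<open>q > 1\<close> by (intro dim_quotient_leI) auto
qed

text \<open>Now \<open>s * (1 - q)\<close> is nonnegative: an upper bound on the cut sum bounds the
  cube sum from above, and division by the negative \<open>q - 1\<close> turns this into the
  required lower bound.\<close>

lemma dim_quotient_le_less_1:
  assumes r: "0 < r" "r < 1" and "0 < q" "q < 1" "s \<ge> 0" "B > 0" and F: "cut_sum n c \<mu> q s r \<le> B"
  shows "dim_quotient \<nu> q r \<le> ereal (s + (ln K + ln B / (1 - q) - s * ln a) / (- ln r))"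
proof -
  let ?P = "\<Sum>u\<in>cut_set n c r. measure \<mu> (cylinder n u) powr q"
  let ?X = "\<Sum>Q\<in>cubes r. measure \<nu> Q powr q"
  have "(r * a) powr (s * (1 - q)) * ?P =
      (\<Sum>u\<in>cut_set n c r. (r * a) powr (s * (1 - q)) * measure \<mu> (cylinder n u) powr q)"
    by (simp add: sum_distrib_left)
  also have "\<dots> \<le> cut_sum n c \<mu> q s r"
    unfolding cut_sum_def using assms a_pos
    by (auto intro!: sum_mono mult_right_mono powr_mono2 mult_nonneg_nonneg elim!: cut_setE)
  finally have P: "(r * a) powr (s * (1 - q)) * ?P \<le> B" using F by simp
  have "(r * a) powr (s * (1 - q)) * ?X \<le> (r * a) powr (s * (1 - q)) * (K powr (1 - q) * ?P)"
    using assms by (intro mult_left_mono sum_cylinder_powr_ge) auto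
  also have "\<dots> = K powr (1 - q) * ((r * a) powr (s * (1 - q)) * ?P)" by simp
  also have "\<dots> \<le> K powr (1 - q) * B" using P by (intro mult_left_mono) auto
  finally have "ln ((r * a) powr (s * (1 - q)) * ?X) \<le> ln (K powr (1 - q) * B)"
    using r a_pos sum_powr_cubes_pos[OF r(1), of q] by (intro ln_mono) auto
  moreover have "ln ((r * a) powr (s * (1 - q)) * ?X) = s * (1 - q) * (ln r + ln a) + ln ?X"
    using r a_pos sum_powr_cubes_pos[OF r(1), of q] by (simp add: ln_mult ln_powr)
  moreover have "ln (K powr (1 - q) * B) = (1 - q) * ln K + ln B"
    using K_pos \<open>B > 0\<close> by (simp add: ln_mult ln_powr)
  \<comment> \<open>Writing \<open>ln B\<close> as a multiple of \<open>1 - q\<close> lets this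
    factor be taken out of the whole bound.\<close>
  moreover define L where "L = ln B / (1 - q)"
  then have "ln B = (1 - q) * L" using \<open>q < 1\<close> by simp
  ultimately have "ln ?X \<le> (1 - q) * (ln K + L - s * ln a - s * ln r)"
    by (simp add: algebra_simps)
  then have "ln ?X \<le> (s * ln r - (ln K + L - s * ln a)) * (q - 1)"
    by (simp add: algebra_simps)
  then have "s * ln r - (ln K + L - s * ln a) \<le> ln ?X / (q - 1)"
    using \<open>q < 1\<close> by (simp add: neg_le_divide_eq)
  then show ?thesis using r \<open>q < 1\<close> unfolding L_def by (intro dim_quotient_leI) auto
qed

text \<open>The sum is logarithmic already, so the threshold is 0 and the loss from Jensen is
  additive.\<close>

lemma dim_quotient_le_1:
  assumes r: "0 < r" "r < 1" and "s \<ge> 0" "M \<le> 1" and F: "0 \<le> cut_sum n c \<mu> 1 s r"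
  shows "dim_quotient \<nu> 1 r \<le> ereal (s + (M * ln K - s * M * ln a) / (- ln r))"
proof -
  let ?P = "\<Sum>u\<in>cut_set n c r. measure \<mu> (cylinder n u) * ln (measure \<mu> (cylinder n u))"
  let ?X = "\<Sum>Q\<in>cubes r. measure \<nu> Q * ln (measure \<nu> Q)"
  have "cut_sum n c \<mu> 1 s r \<le> (\<Sum>u\<in>cut_set n c r.
      measure \<mu> (cylinder n u) * ln (measure \<mu> (cylinder n u)) -
      measure \<mu> (cylinder n u) * (s * (ln r + ln a)))"
    unfolding cut_sum_def if_P[OF refl]
  proof (rule sum_mono)
    fix u assume "u \<in> cut_set n c r"
    then obtain k where u: "u \<in> words n (Suc k)" "r * a \<le> word_ratio c u" by (rule cut_setE)
    show "measure \<mu> (cylinder n u) * ln (word_ratio c u powr - s * measure \<mu> (cylinder n u))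
      \<le> measure \<mu> (cylinder n u) * ln (measure \<mu> (cylinder n u)) -
        measure \<mu> (cylinder n u) * (s * (ln r + ln a))"
    proof (cases "measure \<mu> (cylinder n u) = 0")
      case False
      then have pos: "measure \<mu> (cylinder n u) > 0" by (simp add: less_le)
      have "ln r + ln a = ln (r * a)" using r a_pos by (simp add: ln_mult)
      also have "\<dots> \<le> ln (word_ratio c u)" using u r a_pos by (intro ln_mono) auto
      finally have "s * (ln r + ln a) \<le> s * ln (word_ratio c u)" using \<open>s \<ge> 0\<close> by (intro mult_left_mono)
      moreover have "ln (word_ratio c u powr - s * measure \<mu> (cylinder n u)) =
          - s * ln (word_ratio c u) + ln (measure \<mu> (cylinder n u))"
        using pos word_ratio_pos[OF u(1)] by (simp add: ln_mult ln_powr)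
      ultimately have "ln (word_ratio c u powr - s * measure \<mu> (cylinder n u)) \<le>
          ln (measure \<mu> (cylinder n u)) - s * (ln r + ln a)" by simp
      from mult_left_mono[OF this, of "measure \<mu> (cylinder n u)"] show ?thesis
        by (simp add: right_diff_distrib)
    qed simp
  qed
  also have "\<dots> = ?P - M * (s * (ln r + ln a))"
    using sum_measure_cylinders[OF r] by (simp add: sum_subtractf sum_distrib_right[symmetric])
  finally have "M * (s * (ln r + ln a)) \<le> ?P" using F by simp
  \<comment> \<open>The cut sum controls \<open>M * (s * ln r)\<close>; since \<open>ln r\<close> is
    negative, \<open>M \<le> 1\<close> permits passing to \<open>s * ln r\<close>.\<close>
  moreover have "s * ln r \<le> M * (s * ln r)"
    using mult_right_mono_neg[OF \<open>M \<le> 1\<close>, of "s * ln r"] r \<open>s \<ge> 0\<close> by (simp add: mult_nonneg_nonpos)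
  ultimately have "s * ln r - (M * ln K - s * M * ln a) \<le> ?X"
    using sum_cylinder_mult_ln_le[OF r] by (simp add: algebra_simps)
  then show ?thesis using divide_ln_le[OF r] dim_quotient_1_eq[OF r] by simp
qed

section \<open>The bound by the dimension of the space\<close>

text \<open>Jensen for mass \<open>M\<close> spread over at most \<open>K / r ^ CARD('d)\<close>
  cubes. \<open>M\<close> and \<open>K\<close> affect only the vanishing term, save at
  \<open>q = 1\<close>, where the main term carries the factor \<open>M\<close> and
  \<open>normalized\<close> absorbs it.\<close>

lemma upper_dim_le_dimension:
  assumes "q > 0" and normalized: "q = 1 \<Longrightarrow> M \<le> 1"
  shows "upper_dim q \<nu> \<le> ereal (real CARD('d))"
proof -
  let ?d = "real CARD('d)"
  have "\<exists>C. \<forall>r. 0 < r \<longrightarrow> r < 1 \<longrightarrow> dim_quotient \<nu> q r \<le> ereal (?d + C / (- ln r))"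
  proof -
    consider "q > 1" | "q < 1" | "q = 1" by linarith
    then show ?thesis
    proof cases
      case 1
      show ?thesis
      proof (intro exI allI impI)
        fix r :: real assume r: "0 < r" "r < 1"
        let ?X = "\<Sum>Q\<in>cubes r. measure \<nu> Q powr q"
        have "M powr q \<le> (K / r ^ CARD('d)) powr (q - 1) * ?X"
          using sum_powr_ge[of "cubes r" "measure \<nu>" "K / r ^ CARD('d)" q]
            finite_cubes card_cubes_le[OF r] sum_measure_cubes K_pos r 1 by simp
        then have "ln (M powr q) \<le> ln ((K / r ^ CARD('d)) powr (q - 1) * ?X)"
          using M_pos by (intro ln_mono) auto
        then have "q * ln M \<le> (q - 1) * (ln K - ?d * ln r) + ln ?X"
          using M_pos K_pos r sum_powr_cubes_pos[OF r(1), of q]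
          by (simp add: ln_mult ln_powr ln_div ln_realpow)
        moreover define L where "L = q * ln M / (q - 1)"
        then have "q * ln M = (q - 1) * L" using 1 by simp
        ultimately have "(?d * ln r - (ln K - L)) * (q - 1) \<le> ln ?X"
          by (simp add: algebra_simps)
        then have "?d * ln r - (ln K - L) \<le> ln ?X / (q - 1)"
          using 1 by (simp add: pos_le_divide_eq)
        then show "dim_quotient \<nu> q r \<le> ereal (?d + (ln K - q * ln M / (q - 1)) / (- ln r))"
          using r 1 unfolding L_def by (intro dim_quotient_leI) auto
      qed
    next
      case 2
      show ?thesis
      proof (intro exI allI impI)
        fix r :: real assume r: "0 < r" "r < 1"
        let ?X = "\<Sum>Q\<in>cubes r. measure \<nu> Q powr q"
        have "?X \<le> (K / r ^ CARD('d)) powr (1 - q) * M powr q"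
          using sum_powr_le[of "cubes r" "measure \<nu>" "K / r ^ CARD('d)" q]
            finite_cubes card_cubes_le[OF r] sum_measure_cubes K_pos r 2 \<open>q > 0\<close> by simp
        then have "ln ?X \<le> ln ((K / r ^ CARD('d)) powr (1 - q) * M powr q)"
          using sum_powr_cubes_pos[OF r(1), of q] by (intro ln_mono) auto
        then have "ln ?X \<le> (1 - q) * (ln K - ?d * ln r) + q * ln M"
          using M_pos K_pos r by (simp add: ln_mult ln_powr ln_div ln_realpow)
        moreover define L where "L = q * ln M / (q - 1)"
        then have "q * ln M = (q - 1) * L" using 2 by simp
        ultimately have "ln ?X \<le> (?d * ln r - (ln K - L)) * (q - 1)"
          by (simp add: algebra_simps)
        then have "?d * ln r - (ln K - L) \<le> ln ?X / (q - 1)"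
          using 2 by (simp add: neg_le_divide_eq)
        then show "dim_quotient \<nu> q r \<le> ereal (?d + (ln K - q * ln M / (q - 1)) / (- ln r))"
          using r 2 unfolding L_def by (intro dim_quotient_leI) auto
      qed
    next
      case 3
      show ?thesis
      proof (intro exI allI impI)
        fix r :: real assume r: "0 < r" "r < 1"
        let ?X = "\<Sum>Q\<in>cubes r. measure \<nu> Q * ln (measure \<nu> Q)"
        have "M * ln M - M * ln (K / r ^ CARD('d)) \<le> ?X"
          using sum_mult_ln_ge[of "cubes r" "measure \<nu>" "K / r ^ CARD('d)"]
            finite_cubes card_cubes_le[OF r] sum_measure_cubes K_pos r by simp
        then have "M * ln M - M * (ln K - ?d * ln r) \<le> ?X"
          using K_pos r by (simp add: ln_div ln_realpow)
        moreover have "?d * ln r \<le> M * (?d * ln r)"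
          using mult_right_mono_neg[OF normalized[OF 3], of "?d * ln r"] r by (simp add: mult_nonneg_nonpos)
        ultimately have "?d * ln r - (M * ln K - M * ln M) \<le> ?X" by (simp add: algebra_simps)
        then show "dim_quotient \<nu> q r \<le> ereal (?d + (M * ln K - M * ln M) / (- ln r))"
          using divide_ln_le[OF r] dim_quotient_1_eq[OF r] 3 by simp
      qed
    qed
  qed
  then obtain C where "\<And>r. 0 < r \<Longrightarrow> r < 1 \<Longrightarrow> dim_quotient \<nu> q r \<le> ereal (?d + C / (- ln r))" by blast
  then have "\<forall>\<^sub>F r in at_right 0. dim_quotient \<nu> q r \<le> ereal (?d + C / (- ln r))"
    by (intro eventually_mono[OF eventually_unit_interval]) blast
  then show ?thesis unfolding upper_dim_def by (rule Limsup_le_of_eventually_le_ln)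
qed

section \<open>The bounds by the critical values\<close>

text \<open>Joins \<open>q = 1\<close> and \<open>q > 1\<close> under the common threshold 1; only
  the constant differs, and it does not depend on \<open>r\<close>.\<close>

lemma dim_quotient_le_ge_1:
  assumes "q \<ge> 1" "s \<ge> 0" and normalized: "q = 1 \<Longrightarrow> M \<le> 1"
  obtains C where "\<And>r. 0 < r \<Longrightarrow> r < 1 \<Longrightarrow> 1 \<le> cut_sum n c \<mu> q s r \<Longrightarrow>
    dim_quotient \<nu> q r \<le> ereal (s + C / (- ln r))"
proof (cases "q = 1")
  case True
  show ?thesis
  proof (rule that)
    fix r :: real assume "0 < r" "r < 1" "1 \<le> cut_sum n c \<mu> q s r"
    then show "dim_quotient \<nu> q r \<le> ereal (s + (M * ln K - s * M * ln a) / (- ln r))"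
      using dim_quotient_le_1[of r s] True assms by simp
  qed
next
  case False
  show ?thesis
  proof (rule that)
    fix r :: real assume "0 < r" "r < 1" "1 \<le> cut_sum n c \<mu> q s r"
    then show "dim_quotient \<nu> q r \<le> ereal (s + (ln K - s * ln a) / (- ln r))"
      using dim_quotient_le_gt_1[of r q s] False assms by simp
  qed
qed

text \<open>For \<open>q \<ge> 1\<close> any \<open>s\<close> above the supremum has an infinite
  upper limit, so the cut sum is at least 1 for arbitrarily small \<open>r\<close>. For
  \<open>q < 1\<close> any admissible \<open>s\<close> has cut sums bounded along arbitrarily small
  \<open>r\<close>. Either suffices for a lower limit.\<close>

lemma lower_dim_le_lower_critical:
  assumes "q > 0" and normalized: "q = 1 \<Longrightarrow> M \<le> 1"
  shows "lower_dim q \<nu> \<le> lower_critical n c \<mu> q"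
proof (cases "q \<ge> 1")
  case True
  show ?thesis
  proof (rule ccontr)
    assume "\<not> ?thesis"
    then obtain s where s: "lower_critical n c \<mu> q < ereal s" "ereal s < lower_dim q \<nu>"
      using ereal_dense2 by (meson not_le)
    let ?S = "{ereal s | s. s > 0 \<and> Limsup (at_right 0) (\<lambda>r. ereal (cut_sum n c \<mu> q s r)) < \<infinity>}"
    have Sup: "lower_critical n c \<mu> q = Sup (insert 0 ?S)" using True by (simp add: lower_critical_def)
    \<comment> \<open>The inserted 0 makes the supremum nonnegative, so \<open>s\<close> is positive
      and can be missing from the set only by failing the limit condition.\<close>
    have "0 \<le> lower_critical n c \<mu> q" unfolding Sup by (rule Sup_upper) simp
    then have "s > 0" using s(1) by (metis ereal_less(2) le_less_trans)
    have "ereal s \<notin> ?S" using s(1) unfolding Sup by (meson Sup_upper insertI2 not_le)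
    then have infinite: "\<not> Limsup (at_right 0) (\<lambda>r. ereal (cut_sum n c \<mu> q s r)) < \<infinity>"
      using \<open>s > 0\<close> by blast
    have "\<exists>\<^sub>F r in at_right 0. 1 \<le> cut_sum n c \<mu> q s r"
    proof (rule ccontr)
      assume "\<not> ?thesis"
      then have "\<forall>\<^sub>F r in at_right 0. ereal (cut_sum n c \<mu> q s r) \<le> 1"
        unfolding not_frequently by (rule eventually_mono) simp
      then have "Limsup (at_right 0) (\<lambda>r. ereal (cut_sum n c \<mu> q s r)) \<le> 1" by (rule Limsup_bounded)
      then show False using infinite by (auto simp: top.not_eq_extremum)
    qed
    moreover obtain C where "\<And>r. 0 < r \<Longrightarrow> r < 1 \<Longrightarrow> 1 \<le> cut_sum n c \<mu> q s r \<Longrightarrow>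
        dim_quotient \<nu> q r \<le> ereal (s + C / (- ln r))"
      using dim_quotient_le_ge_1[OF True, of s] \<open>s > 0\<close> normalized by force
    ultimately have "\<exists>\<^sub>F r in at_right 0. dim_quotient \<nu> q r \<le> ereal (s + C / (- ln r))"
      by (elim frequently_rev_mp) (rule eventually_mono[OF eventually_unit_interval], blast)
    then have "lower_dim q \<nu> \<le> ereal s"
      unfolding lower_dim_def by (rule Liminf_le_of_frequently_le_ln)
    then show False using s(2) by simp
  qed
next
  case False
  show ?thesis
    unfolding lower_critical_def if_not_P[OF False]
  proof (rule Inf_greatest, clarify)
    fix s :: real assume s: "s > 0" "Liminf (at_right 0) (\<lambda>r. ereal (cut_sum n c \<mu> q s r)) < \<infinity>"
    \<comment> \<open>This bound may be negative; \<open>max B 1\<close> below is positive, as its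
      logarithm requires.\<close>
    obtain B where B: "Liminf (at_right 0) (\<lambda>r. ereal (cut_sum n c \<mu> q s r)) < ereal B"
      using ereal_dense2[OF s(2)] by blast
    have "\<exists>\<^sub>F r in at_right 0. cut_sum n c \<mu> q s r \<le> max B 1"
    proof (rule ccontr)
      assume "\<not> ?thesis"
      then have "\<forall>\<^sub>F r in at_right 0. ereal B \<le> ereal (cut_sum n c \<mu> q s r)"
        unfolding not_frequently by (rule eventually_mono) simp
      then have "ereal B \<le> Liminf (at_right 0) (\<lambda>r. ereal (cut_sum n c \<mu> q s r))" by (rule Liminf_bounded)
      then show False using B by simp
    qed
    moreover have "dim_quotient \<nu> q r \<le> ereal (s + (ln K + ln (max B 1) / (1 - q) - s * ln a) / (- ln r))"
      if "0 < r" "r < 1" "cut_sum n c \<mu> q s r \<le> max B 1" for r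
      using that False s(1) \<open>q > 0\<close> by (intro dim_quotient_le_less_1) auto
    ultimately have "\<exists>\<^sub>F r in at_right 0. dim_quotient \<nu> q r \<le>
        ereal (s + (ln K + ln (max B 1) / (1 - q) - s * ln a) / (- ln r))"
      by (elim frequently_rev_mp) (rule eventually_mono[OF eventually_unit_interval], blast)
    then show "lower_dim q \<nu> \<le> ereal s"
      unfolding lower_dim_def by (rule Liminf_le_of_frequently_le_ln)
  qed
qed

text \<open>As for the lower dimension, but for all small \<open>r\<close>: an infinite lower limit
  makes the cut sum eventually at least 1, and a finite upper limit makes it eventually
  bounded.\<close>

lemma upper_dim_le_upper_critical:
  assumes "q > 0" and normalized: "q = 1 \<Longrightarrow> M \<le> 1"
  shows "upper_dim q \<nu> \<le> upper_critical n c \<mu> q"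
proof (cases "q \<ge> 1")
  case True
  show ?thesis
  proof (rule ccontr)
    assume "\<not> ?thesis"
    then obtain s where s: "upper_critical n c \<mu> q < ereal s" "ereal s < upper_dim q \<nu>"
      using ereal_dense2 by (meson not_le)
    let ?S = "{ereal s | s. s > 0 \<and> Liminf (at_right 0) (\<lambda>r. ereal (cut_sum n c \<mu> q s r)) < \<infinity>}"
    have Sup: "upper_critical n c \<mu> q = Sup (insert 0 ?S)" using True by (simp add: upper_critical_def)
    have "0 \<le> upper_critical n c \<mu> q" unfolding Sup by (rule Sup_upper) simp
    then have "s > 0" using s(1) by (metis ereal_less(2) le_less_trans)
    have "ereal s \<notin> ?S" using s(1) unfolding Sup by (meson Sup_upper insertI2 not_le)
    then have "\<not> Liminf (at_right 0) (\<lambda>r. ereal (cut_sum n c \<mu> q s r)) < \<infinity>"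
      using \<open>s > 0\<close> by blast
    then have "1 < Liminf (at_right 0) (\<lambda>r. ereal (cut_sum n c \<mu> q s r))"
      by (auto simp: top.not_eq_extremum)
    then have "\<forall>\<^sub>F r in at_right 0. 1 \<le> cut_sum n c \<mu> q s r"
      by (rule eventually_mono[OF less_LiminfD]) simp
    moreover obtain C where "\<And>r. 0 < r \<Longrightarrow> r < 1 \<Longrightarrow> 1 \<le> cut_sum n c \<mu> q s r \<Longrightarrow>
        dim_quotient \<nu> q r \<le> ereal (s + C / (- ln r))"
      using dim_quotient_le_ge_1[OF True, of s] \<open>s > 0\<close> normalized by force
    ultimately have "\<forall>\<^sub>F r in at_right 0. dim_quotient \<nu> q r \<le> ereal (s + C / (- ln r))"
      using eventually_unit_interval by (auto elim: eventually_elim2)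
    then have "upper_dim q \<nu> \<le> ereal s"
      unfolding upper_dim_def by (rule Limsup_le_of_eventually_le_ln)
    then show False using s(2) by simp
  qed
next
  case False
  show ?thesis
    unfolding upper_critical_def if_not_P[OF False]
  proof (rule Inf_greatest, clarify)
    fix s :: real assume s: "s > 0" "Limsup (at_right 0) (\<lambda>r. ereal (cut_sum n c \<mu> q s r)) < \<infinity>"
    obtain B where B: "Limsup (at_right 0) (\<lambda>r. ereal (cut_sum n c \<mu> q s r)) < ereal B"
      using ereal_dense2[OF s(2)] by blast
    have "\<forall>\<^sub>F r in at_right 0. cut_sum n c \<mu> q s r \<le> max B 1"
      by (rule eventually_mono[OF Limsup_lessD[OF B]]) simp
    then have "\<forall>\<^sub>F r in at_right 0. dim_quotient \<nu> q r \<le>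
        ereal (s + (ln K + ln (max B 1) / (1 - q) - s * ln a) / (- ln r))"
      using eventually_unit_interval
    proof eventually_elim
      case (elim r)
      then show ?case using False s(1) \<open>q > 0\<close> by (intro dim_quotient_le_less_1) auto
    qed
    then show "upper_dim q \<nu> \<le> ereal s"
      unfolding upper_dim_def by (rule Limsup_le_of_eventually_le_ln)
  qed
qed

end

text \<open>At \<open>q = 1\<close> scaling \<mu> by a constant scales the dimensions but not the
  critical values, so \<open>normalized\<close> bounds the total mass there; for other
  \<open>q\<close> scaling only shifts a logarithm.\<close>

theorem theorem2p1:
  fixes n :: "nat \<Rightarrow> nat"
    and J E :: "(real ^ 'd) set"
    and S :: "nat \<Rightarrow> nat \<Rightarrow> real ^ 'd \<Rightarrow> real ^ 'd"
    and \<omega> :: "nat list \<Rightarrow> real ^ 'd"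
    and JJ :: "nat list \<Rightarrow> (real ^ 'd) set"
    and c :: "nat \<Rightarrow> nat \<Rightarrow> real"
    and \<mu> :: "(nat \<Rightarrow> nat) measure"
    and q :: real
  assumes attractor: "nonautonomous_attractor n J S \<omega> JJ E"
    and borel: "sets \<mu> = sets (borel_words n)"
    and finite: "finite_measure \<mu>"
    and positive: "measure \<mu> (space \<mu>) > 0"
    and lipschitz: "\<And>k i x y. k \<ge> 1 \<Longrightarrow> i \<in> {1..n k} \<Longrightarrow> x \<in> J \<Longrightarrow> y \<in> J \<Longrightarrow>
      norm (S k i x - S k i y) \<le> c k i * norm (x - y)"
    and ratio_less_1: "\<And>k i. k \<ge> 1 \<Longrightarrow> i \<in> {1..n k} \<Longrightarrow> c k i < 1"
    and inf_pos: "(INF (k, i)\<in>(SIGMA k:{1..}. {1..n k}). c k i) > 0"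
    and sup_less_1: "(SUP (k, i)\<in>(SIGMA k:{1..}. {1..n k}). c k i) < 1"
    and q_pos: "q > 0"
    and normalized: "q = 1 \<Longrightarrow> measure \<mu> (space \<mu>) \<le> 1"
  shows "lower_dim q (image_measure JJ \<mu>) \<le> min (lower_critical n c \<mu> q) (ereal (real CARD('d)))
       \<and> upper_dim q (image_measure JJ \<mu>) \<le> min (upper_critical n c \<mu> q) (ereal (real CARD('d)))"
proof -
  let ?I = "SIGMA k:{1::nat..}. {1..n k}"
  define a where "a = (INF (k, i)\<in>?I. c k i)"
  define b where "b = (SUP (k, i)\<in>?I. c k i)"
  have structure': "nonautonomous_structure n J S \<omega> JJ"
    using attractor by (simp add: nonautonomous_attractor_def)
  \<comment> \<open>A nonempty open set supplies two distinct points, at which the Lipschitz bound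
    forces the ratios to be nonnegative.\<close>
  have "interior J \<noteq> {}" using structure' by (simp add: nonautonomous_structure_def)
  then obtain x where x: "x \<in> interior J" by blast
  then have "interior J \<noteq> {x}" using not_open_singleton[of x] open_interior[of J] by metis
  then obtain y where y: "y \<in> interior J" "y \<noteq> x" using x by blast
  have nonneg: "0 \<le> c k i" if "k \<ge> 1" "i \<in> {1..n k}" for k i
  proof -
    have "0 \<le> c k i * norm (x - y)"
      using lipschitz[OF that, of x y] x y interior_subset[of J] norm_ge_zero[of "S k i x - S k i y"]
      by (meson order_trans subsetD)
    then show ?thesis using y by (simp add: zero_le_mult_iff)
  qed
  have lower: "a \<le> c k i" if "k \<ge> 1" "i \<in> {1..n k}" for k i
  proof -
    \<comment> \<open>A real infimum bounds its set only if the set is bounded below; nonnegativity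
      provides this.\<close>
    have "bdd_below ((\<lambda>(k, i). c k i) ` ?I)" using nonneg by (intro bdd_belowI[of _ 0]) auto
    from cINF_lower[OF this, of "(k, i)"] show ?thesis using that by (simp add: a_def)
  qed
  have upper: "c k i \<le> b" if "k \<ge> 1" "i \<in> {1..n k}" for k i
  proof -
    have "bdd_above ((\<lambda>(k, i). c k i) ` ?I)"
      using ratio_less_1 by (intro bdd_aboveI[of _ 1]) (auto intro: less_imp_le)
    from cSUP_upper[OF _ this, of "(k, i)"] show ?thesis using that by (simp add: b_def)
  qed
  interpret finite_measure \<mu> by (rule finite)
  interpret bounded_ratio_attractor_measure n J S \<omega> JJ c a b \<mu>
    using structure' lipschitz lower upper inf_pos sup_less_1 borel positive
    by unfold_locales (auto simp: a_def b_def)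
  have normalized': "M \<le> 1" if "q = 1" using normalized[OF that] by (simp add: M_def)
  have upper_le: "upper_dim q (image_measure JJ \<mu>) \<le> ereal (real CARD('d))"
    by (intro upper_dim_le_dimension q_pos normalized')
  \<comment> \<open>The bound by the dimension reaches the lower limit through the upper
    one.\<close>
  have "lower_dim q (image_measure JJ \<mu>) \<le> upper_dim q (image_measure JJ \<mu>)"
    unfolding lower_dim_def upper_dim_def by (intro Liminf_le_Limsup) simp
  then show ?thesis
    using upper_le lower_dim_le_lower_critical[OF q_pos normalized']
      upper_dim_le_upper_critical[OF q_pos normalized'] by simp
qed

end
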